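(* Let $\Phi$ be a quantum channel from $\mathcal{H}$ to $\mathcal{K}$ with Stinespring form $\Phi(X)=\operatorname{tr}_{\mathcal{B}}U(|0\rangle\langle0|\otimes X)U^*$, $|0\rangle\in\mathcal{A}$, $U$ unitary from $\mathcal{A}\otimes\mathcal{H}$ to $\mathcal{K}\otimes\mathcal{B}$, and let $\Phi'$ be the mixed-unitary channel from $\mathcal{A}\otimes\mathcal{H}$ to $\mathcal{K}\otimes\mathcal{B}$ constructed below. Then $S_{\min}(\Phi)\ge S_{\min}(\Phi')-\log\dim\mathcal{B}\ge S_{\min}(\Phi)-1/\dim\mathcal{A}$.
   Context: $S(\rho)=-\operatorname{tr}\rho\log\rho$ (log base 2), $S_{\min}(\Phi)=\min_\rho S(\Phi(\rho))$ over input density operators. Construction: let $S_0=|0\rangle\otimes\mathcal{H}$ and $S_0^\perp$ its orthogonal complement in $\mathcal{A}\otimes\mathcal{H}$. $D_{S_0}(\rho)=\tfrac12(V\rho V^*+\rho)$ with $V$ the identity on $S_0$ and $-1$ on $S_0^\perp$. $M(\rho)=\frac1{e^2}\sum_{a,b=0}^{e-1}(\mathbb{1}_{S_0}\oplus W_{a,b})\rho(\mathbb{1}_{S_0}\oplus W_{a,b})^*$, $e=\dim S_0^\perp$, $W_{a,b}=X^aZ^b$ the discrete Weyl operators on $S_0^\perp$ ($X|j\rangle=|j+1\bmod e\rangle$, $Z|j\rangle=e^{2\pi ij/e}|j\rangle$). $N_{\mathcal{B}}(Y)=\operatorname{tr}_{\mathcal{B}}(Y)\otimes\mathbb{1}_{\mathcal{B}}/\dim\mathcal{B}$.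 Then $\Phi'(\rho)=N_{\mathcal{B}}(U[(M\circ D_{S_0})(\rho)]U^* )$. *)

theory Defs
  imports "Jordan_Normal_Form.Schur_Decomposition" "Jordan_Normal_Form.Char_Poly"
begin

(* Composite systems: basis |i>|j> of A (x) H  <->  index i*dH + j;
   basis |p>|q> of K (x) B  <->  index p*dB + q.  |0> in A is basis vector 0. *)

definition mtrace :: "complex mat \<Rightarrow> complex" where
  "mtrace M = (\<Sum>i<dim_row M. M $$ (i,i))"

definition unitary :: "nat \<Rightarrow> complex mat \<Rightarrow> bool" where
  "unitary n U \<longleftrightarrow> U \<in> carrier_mat n n \<and> mat_adjoint U * U = 1\<^sub>m n \<and> U * mat_adjoint U = 1\<^sub>m n"

definition density :: "nat \<Rightarrow> complex mat \<Rightarrow> bool" where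
  "density n \<rho> \<longleftrightarrow> \<rho> \<in> carrier_mat n n \<and> mat_adjoint \<rho> = \<rho> \<and>
     (\<forall>v\<in>carrier_vec n. 0 \<le> Re (conjugate v \<bullet> (\<rho> *\<^sub>v v))) \<and> mtrace \<rho> = 1"

definition entropy :: "complex mat \<Rightarrow> real" where
  "entropy \<rho> = - (\<Sum>\<^sub># (image_mset (\<lambda>z. let x = Re z in if x \<le> 0 then 0 else x * log 2 x)
                      (proots (char_poly \<rho>))))"

definition Smin :: "nat \<Rightarrow> (complex mat \<Rightarrow> complex mat) \<Rightarrow> real" where
  "Smin n \<Phi> = Inf ((\<lambda>\<rho>. entropy (\<Phi> \<rho>)) ` {\<rho>. density n \<rho>})"

definition ptrace_B :: "nat \<Rightarrow> nat \<Rightarrow> complex mat \<Rightarrow> complex mat" where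
  "ptrace_B dK dB Y = mat dK dK (\<lambda>(p,p'). \<Sum>q<dB. Y $$ (p*dB+q, p'*dB+q))"

(* |0><0| (x) X on A (x) H *)
definition embed0 :: "nat \<Rightarrow> nat \<Rightarrow> complex mat \<Rightarrow> complex mat" where
  "embed0 dA dH X = mat (dA*dH) (dA*dH) (\<lambda>(r,c). if r < dH \<and> c < dH then X $$ (r,c) else 0)"

definition stinespring :: "nat \<Rightarrow> nat \<Rightarrow> nat \<Rightarrow> nat \<Rightarrow> complex mat \<Rightarrow> complex mat \<Rightarrow> complex mat" where
  "stinespring dA dH dK dB U X = ptrace_B dK dB (U * embed0 dA dH X * mat_adjoint U)"

(* V = identity on S_0 = |0> (x) H (indices < dH), -1 on its complement *)
definition Vmat :: "nat \<Rightarrow> nat \<Rightarrow> complex mat" where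
  "Vmat dA dH = mat (dA*dH) (dA*dH) (\<lambda>(i,j). if i = j then (if i < dH then 1 else -1) else 0)"

definition D_S0 :: "nat \<Rightarrow> nat \<Rightarrow> complex mat \<Rightarrow> complex mat" where
  "D_S0 dA dH \<rho> = (1/2 :: complex) \<cdot>\<^sub>m (Vmat dA dH * \<rho> * mat_adjoint (Vmat dA dH) + \<rho>)"

definition shiftX :: "nat \<Rightarrow> complex mat" where
  "shiftX e = mat e e (\<lambda>(j,k). if j = (k + 1) mod e then 1 else 0)"

definition clockZ :: "nat \<Rightarrow> complex mat" where
  "clockZ e = mat e e (\<lambda>(j,k). if j = k then cis (2 * pi * real j / real e) else 0)"

definition weyl :: "nat \<Rightarrow> nat \<Rightarrow> nat \<Rightarrow> complex mat" where
  "weyl e a b = shiftX e ^\<^sub>m a * clockZ e ^\<^sub>m b"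

(* 1_{S_0} (+) W_{a,b} on A (x) H, with S_0^perp = indices dH ..< dA*dH *)
definition weyl_ext :: "nat \<Rightarrow> nat \<Rightarrow> nat \<Rightarrow> nat \<Rightarrow> complex mat" where
  "weyl_ext dA dH a b = (let e = (dA - 1) * dH in
     four_block_mat (1\<^sub>m dH) (0\<^sub>m dH e) (0\<^sub>m e dH) (weyl e a b))"

(* the twirl M; if e = 0 (dim A = 1) there is nothing to twirl and M is the identity *)
definition Mtwirl :: "nat \<Rightarrow> nat \<Rightarrow> complex mat \<Rightarrow> complex mat" where
  "Mtwirl dA dH \<rho> = (let e = (dA - 1) * dH in
     if e = 0 then \<rho> else
     mat (dA*dH) (dA*dH) (\<lambda>(i,j). (1 / (of_nat e)^2) *
       (\<Sum>a<e. \<Sum>b<e. (weyl_ext dA dH a b * \<rho> * mat_adjoint (weyl_ext dA dH a b)) $$ (i,j))))"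

(* N_B(Y) = tr_B(Y) (x) 1_B / dim B *)
definition N_B :: "nat \<Rightarrow> nat \<Rightarrow> complex mat \<Rightarrow> complex mat" where
  "N_B dK dB Y = mat (dK*dB) (dK*dB) (\<lambda>(r,c).
     if r mod dB = c mod dB then ptrace_B dK dB Y $$ (r div dB, c div dB) / of_nat dB else 0)"

definition Phi' :: "nat \<Rightarrow> nat \<Rightarrow> nat \<Rightarrow> nat \<Rightarrow> complex mat \<Rightarrow> complex mat \<Rightarrow> complex mat" where
  "Phi' dA dH dK dB U \<rho> = N_B dK dB (U * Mtwirl dA dH (D_S0 dA dH \<rho>) * mat_adjoint U)"

end

theory Submission
  imports Defs
begin

text \<open>
  Since the dephasing kills the off-diagonal blocks and the twirl depolarizes the block on the
  complement of \<open>S\<^sub>0\<close>, an input with \<open>S\<^sub>0\<close>-block \<open>s \<sigma>\<close>, where \<open>\<sigma>\<close> is a state, produces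
  \<open>s |0\<rangle>\<langle>0| \<otimes> \<sigma> + (1 - s) Q / e\<close>, with \<open>Q\<close> the projection onto the complement and \<open>e\<close> its rank.
  As \<open>N\<^sub>B\<close> adds exactly \<open>log dim B\<close> to the entropy of the reduced state, \<open>S(\<Phi>'(\<rho>)) - log dim B\<close>
  is the entropy of \<open>s \<Phi>(\<sigma>) + (1 - s) \<tau>\<close>, where \<open>\<tau>\<close> is the reduction of \<open>Q / e\<close>. Taking
  \<open>s = 1\<close> gives the first inequality.

  For the second one, concavity of the entropy reduces the claim to
  \<open>S(\<tau>) \<ge> S(\<omega>) - 1 / dim A\<close> for \<open>\<omega> = \<Phi>(1 / dim H)\<close>. The states \<open>\<tau>\<close> and \<open>\<omega>\<close> commute: an
  eigenvalue \<open>x / dim K\<close> of \<open>\<omega>\<close> corresponds to the eigenvalue \<open>y / dim K\<close> of \<open>\<tau>\<close>, with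
  \<open>y = (dim A - x) / (dim A - 1)\<close>. The rescaled eigenvalues \<open>x\<close> have mean 1, so it suffices to
  bound \<open>y ln y - x ln x\<close> by \<open>ln 2 / dim A\<close> plus a multiple of \<open>x - 1\<close>.
\<close>

section \<open>Unitary diagonalization of Hermitian matrices\<close>

lemma dim_mat_adjoint [simp]:
  "dim_row (mat_adjoint A) = dim_col A" "dim_col (mat_adjoint A) = dim_row A"
  by (simp_all add: mat_adjoint_def)

lemma mat_adjoint_carrier [simp]:
  "mat_adjoint A \<in> carrier_mat n m \<longleftrightarrow> A \<in> carrier_mat m n"
  unfolding carrier_mat_def mem_Collect_eq dim_mat_adjoint by blast

lemma index_mat_adjoint [simp]:
  "i < dim_col A \<Longrightarrow> j < dim_row A \<Longrightarrow> mat_adjoint A $$ (i, j) = conjugate (A $$ (j, i))"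
  by (simp add: mat_adjoint_def mat_of_rows_def)

lemma index_mat_mult_sum:
  assumes "A \<in> carrier_mat n m" "B \<in> carrier_mat m k" "i < n" "j < k"
  shows "(A * B) $$ (i, j) = (\<Sum>l<m. A $$ (i, l) * B $$ (l, j))"
  using assms by (auto simp: scalar_prod_def atLeast0LessThan)

lemma mat_adjoint_mult:
  fixes A B :: "complex mat"
  assumes "A \<in> carrier_mat n m" "B \<in> carrier_mat m k"
  shows "mat_adjoint (A * B) = mat_adjoint B * mat_adjoint A"
proof (rule eq_matI)
  fix i j assume "i < dim_row (mat_adjoint B * mat_adjoint A)" "j < dim_col (mat_adjoint B * mat_adjoint A)"
  then have ij: "i < k" "j < n" using assms by auto
  have "mat_adjoint (A * B) $$ (i, j) = cnj ((A * B) $$ (j, i))" using assms ij by simp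
  also have "\<dots> = (\<Sum>l<m. mat_adjoint B $$ (i, l) * mat_adjoint A $$ (l, j))"
    unfolding index_mat_mult_sum[OF assms ij(2,1)] using assms ij by (simp add: mult.commute)
  also have "\<dots> = (mat_adjoint B * mat_adjoint A) $$ (i, j)"
    using assms ij by (subst index_mat_mult_sum[of _ k m _ n]) auto
  finally show "mat_adjoint (A * B) $$ (i, j) = (mat_adjoint B * mat_adjoint A) $$ (i, j)" .
qed (use assms in auto)

lemma mat_adjoint_adjoint [simp]: "mat_adjoint (mat_adjoint A) = (A :: complex mat)"
  by (rule eq_matI) auto

lemma mat_adjoint_one [simp]: "mat_adjoint (1\<^sub>m n) = (1\<^sub>m n :: complex mat)"
  by (rule eq_matI) auto

lemma unitaryD:
  assumes "unitary n U"
  shows "U \<in> carrier_mat n n" "mat_adjoint U \<in> carrier_mat n n"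
    "mat_adjoint U * U = 1\<^sub>m n" "U * mat_adjoint U = 1\<^sub>m n"
  using assms by (auto simp: unitary_def)

lemma unitaryI:
  assumes "U \<in> carrier_mat n n" "mat_adjoint U * U = 1\<^sub>m n"
  shows "unitary n U"
  unfolding unitary_def using assms mat_mult_left_right_inverse[of "mat_adjoint U" n U] by auto

lemma unitary_adjoint: "unitary n U \<Longrightarrow> unitary n (mat_adjoint U)"
  by (auto simp: unitary_def)

lemma unitary_one: "unitary n (1\<^sub>m n)"
  by (auto simp: unitary_def)

lemma unitary_mult:
  assumes U: "unitary n U" and V: "unitary n V"
  shows "unitary n (U * V)"
proof (rule unitaryI)
  note u = unitaryD[OF U] and v = unitaryD[OF V]
  show "U * V \<in> carrier_mat n n" using u v by auto
  have "mat_adjoint (U * V) * (U * V) = mat_adjoint V * mat_adjoint U * (U * V)"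
    using u v by (simp add: mat_adjoint_mult[of _ n n _ n])
  also have "\<dots> = mat_adjoint V * ((mat_adjoint U * U) * V)"
    using u(1,2) v(1,2) by (simp add: assoc_mult_mat[of _ n n _ n _ n])
  finally show "mat_adjoint (U * V) * (U * V) = 1\<^sub>m n" using u v by simp
qed

lemma unitary_conj_cancel:
  assumes U: "unitary n U" and A: "A \<in> carrier_mat n n"
  shows "U * (mat_adjoint U * A * U) * mat_adjoint U = A"
proof -
  note u = unitaryD[OF U]
  have "U * (mat_adjoint U * A * U) * mat_adjoint U = (U * mat_adjoint U) * A * (U * mat_adjoint U)"
    using u(1,2) A by (simp add: assoc_mult_mat[of _ n n _ n _ n])
  then show ?thesis using u A by simp
qed

lemma unitary_conj_mult:
  assumes U: "unitary n U" and V: "unitary n V" and A: "A \<in> carrier_mat n n"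
  shows "U * (V * A * mat_adjoint V) * mat_adjoint U = (U * V) * A * mat_adjoint (U * V)"
  using unitaryD[OF U] unitaryD[OF V] A
  by (simp add: mat_adjoint_mult[of _ n n _ n] assoc_mult_mat[of _ n n _ n _ n])

text \<open>Gram-Schmidt applied to a basis that begins with \<open>v\<close> keeps \<open>v\<close>
  as its first vector. Normalizing the resulting vectors gives the columns of \<open>W\<close>, so
  \<open>c\<close> is the inverse of the norm of \<open>v\<close>.\<close>

lemma exists_unitary_first_col:
  fixes v :: "complex vec"
  assumes v: "v \<in> carrier_vec n" and v0: "v \<noteq> 0\<^sub>v n" and n: "n \<noteq> 0"
  shows "\<exists>W c. unitary n W \<and> col W 0 = c \<cdot>\<^sub>v v"
proof -
  interpret cof_vec_space n "TYPE(complex)" .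
  define b where "b = basis_completion v"
  define ws where "ws = gram_schmidt n b"
  from basis_completion[OF v v0, folded b_def]
  have dist_b: "distinct b" and indep: "\<not> lin_dep (set b)" and b: "set b \<subseteq> carrier_vec n"
    and hdb: "hd b = v" and len_b: "length b = n" by auto
  from hdb len_b n obtain vs where bv: "b = v # vs" by (cases b, auto)
  from gram_schmidt_result[OF b dist_b indep refl, folded ws_def]
  have ws: "set ws \<subseteq> carrier_vec n" "corthogonal ws" "length ws = n"
    by (auto simp: len_b)
  from gram_schmidt_hd[OF v, of vs, folded bv] have hdws: "hd ws = v" unfolding ws_def .
  have wsc: "ws ! i \<in> carrier_vec n" if "i < n" for i using ws that by auto
  \<comment> \<open>The vectors \<open>ws\<close> are orthogonal but not normalized;
    \<open>N i\<close> is the squared norm of the i-th one, and its square root divides the columns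
    of \<open>W\<close> below.\<close>
  define N where "N i = (\<Sum>l<n. (cmod (ws ! i $ l))\<^sup>2)" for i
  have ip: "(\<Sum>l<n. ws ! i $ l * cnj (ws ! j $ l)) = (ws ! i) \<bullet>c (ws ! j)" if "i < n" "j < n" for i j
    using wsc[OF that(1)] wsc[OF that(2)] by (auto simp: scalar_prod_def atLeast0LessThan)
  have Nip: "complex_of_real (N i) = (ws ! i) \<bullet>c (ws ! i)" if "i < n" for i
    unfolding ip[OF that that, symmetric] N_def by (simp add: complex_mult_cnj cmod_def)
  have N0: "N i > 0" if "i < n" for i
  proof -
    have "(ws ! i) \<bullet>c (ws ! i) \<noteq> 0" using corthogonalD[OF ws(2)] that ws(3) by auto
    then have "N i \<noteq> 0" using Nip[OF that] by auto
    moreover have "N i \<ge> 0" unfolding N_def by (intro sum_nonneg) auto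
    ultimately show ?thesis by simp
  qed
  define W where "W = mat n n (\<lambda>(l, i). ws ! i $ l / complex_of_real (sqrt (N i)))"
  have W: "W \<in> carrier_mat n n" by (simp add: W_def)
  have "mat_adjoint W * W = 1\<^sub>m n"
  proof (rule eq_matI)
    fix i j assume "i < dim_row (1\<^sub>m n :: complex mat)" "j < dim_col (1\<^sub>m n :: complex mat)"
    then have ij: "i < n" "j < n" by auto
    have "(mat_adjoint W * W) $$ (i, j)
      = (\<Sum>l<n. cnj (ws ! i $ l / complex_of_real (sqrt (N i))) * (ws ! j $ l / complex_of_real (sqrt (N j))))"
      using ij by (subst index_mat_mult_sum[of _ n n _ n]) (auto simp: W_def)
    also have "\<dots> = (\<Sum>l<n. ws ! j $ l * cnj (ws ! i $ l)) / (complex_of_real (sqrt (N i)) * complex_of_real (sqrt (N j)))"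
      by (simp add: sum_divide_distrib mult.commute)
    also have "\<dots> = 1\<^sub>m n $$ (i, j)"
    proof (cases "i = j")
      case True
      have "complex_of_real (sqrt (N j)) * complex_of_real (sqrt (N j)) = complex_of_real (N j)"
        using N0[OF ij(2)] by (simp flip: of_real_mult)
      then show ?thesis using True ij N0[OF ij(2)] by (simp add: ip Nip[symmetric])
    next
      case False
      then show ?thesis using ij corthogonalD[OF ws(2), of j i] ws(3) by (simp add: ip)
    qed
    finally show "(mat_adjoint W * W) $$ (i, j) = 1\<^sub>m n $$ (i, j)" .
  qed (use W in auto)
  with W have "unitary n W" by (rule unitaryI)
  moreover have "col W 0 = (1 / complex_of_real (sqrt (N 0))) \<cdot>\<^sub>v v"
  proof (rule eq_vecI)
    have "ws ! 0 = v" using hdws n ws(3) by (cases ws) auto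
    then show "\<And>i. i < dim_vec ((1 / complex_of_real (sqrt (N 0))) \<cdot>\<^sub>v v) \<Longrightarrow>
         col W 0 $ i = ((1 / complex_of_real (sqrt (N 0))) \<cdot>\<^sub>v v) $ i"
      using v n by (auto simp: W_def)
  qed (use W v in auto)
  ultimately show ?thesis by blast
qed

definition real_diag :: "nat \<Rightarrow> (nat \<Rightarrow> real) \<Rightarrow> complex mat" where
  "real_diag n d = mat n n (\<lambda>(i, j). if i = j then complex_of_real (d i) else 0)"

lemma real_diag_carrier [simp]: "real_diag n d \<in> carrier_mat n n"
  by (simp add: real_diag_def)

lemma dim_real_diag [simp]: "dim_row (real_diag n d) = n" "dim_col (real_diag n d) = n"
  by (simp_all add: real_diag_def)

lemma exists_complex_eigenvalue:
  assumes A: "(A :: complex mat) \<in> carrier_mat n n" and n: "n \<noteq> 0"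
  shows "\<exists>e. eigenvalue A e"
proof -
  have "degree (char_poly A) = n" using degree_monic_char_poly[OF A] by simp
  then have "\<not> constant (poly (char_poly A))" using n by (simp add: constant_degree)
  then obtain z where "poly (char_poly A) z = 0" using fundamental_theorem_of_algebra by blast
  then show ?thesis using eigenvalue_root_char_poly[OF A] by blast
qed

text \<open>Deflation: a unitary change of basis moves an eigenvector to the first basis vector.
  Hermiticity then clears the first row together with the first column and makes the eigenvalue
  real, and the induction hypothesis handles the remaining Hermitian block.\<close>

lemma hermitian_diagonalization:
  assumes "A \<in> carrier_mat n n" "mat_adjoint A = A"
  shows "\<exists>P d. unitary n P \<and> A = P * real_diag n d * mat_adjoint P"
  using assms
proof (induction n arbitrary: A)
  case 0
  have "A = 1\<^sub>m 0 * real_diag 0 (\<lambda>_. 0) * mat_adjoint (1\<^sub>m 0)"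
    using 0 by (intro eq_matI) auto
  then show ?case using unitary_one by blast
next
  case (Suc n A)
  let ?n = "Suc n"
  obtain e where "eigenvalue A e" using exists_complex_eigenvalue[OF Suc.prems(1)] by auto
  then obtain v where v: "v \<in> carrier_vec ?n" "v \<noteq> 0\<^sub>v ?n" "A *\<^sub>v v = e \<cdot>\<^sub>v v"
    using Suc.prems(1) unfolding eigenvalue_def eigenvector_def by auto
  obtain W c where W: "unitary ?n W" and Wc: "col W 0 = c \<cdot>\<^sub>v v"
    using exists_unitary_first_col[OF v(1,2)] by auto
  note w = unitaryD[OF W]
  note A = Suc.prems(1)
  define B where "B = mat_adjoint W * A * W"
  have B: "B \<in> carrier_mat ?n ?n" using w A by (auto simp: B_def)
  have Bh: "mat_adjoint B = B"
    using w A Suc.prems(2)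
    by (simp add: B_def mat_adjoint_mult[of _ ?n ?n _ ?n] assoc_mult_mat[of _ ?n ?n _ ?n _ ?n])
  have Bc: "col B 0 = e \<cdot>\<^sub>v col (1\<^sub>m ?n) 0"
  proof -
    have "col B 0 = mat_adjoint W * A *\<^sub>v col W 0"
      unfolding B_def using w A by (intro col_mult2[of _ ?n ?n _ ?n]) auto
    also have "\<dots> = mat_adjoint W *\<^sub>v (A *\<^sub>v (c \<cdot>\<^sub>v v))"
      unfolding Wc using w A v by (intro assoc_mult_mat_vec) auto
    also have "A *\<^sub>v (c \<cdot>\<^sub>v v) = c \<cdot>\<^sub>v (e \<cdot>\<^sub>v v)"
      using A v by (simp add: mult_mat_vec[of _ ?n ?n])
    also have "\<dots> = e \<cdot>\<^sub>v (c \<cdot>\<^sub>v v)" by (simp add: smult_smult_assoc mult.commute)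
    also have "mat_adjoint W *\<^sub>v (e \<cdot>\<^sub>v (c \<cdot>\<^sub>v v)) = e \<cdot>\<^sub>v (mat_adjoint W *\<^sub>v col W 0)"
      unfolding Wc using w v by (intro mult_mat_vec) auto
    also have "mat_adjoint W *\<^sub>v col W 0 = col (mat_adjoint W * W) 0"
      using w by (intro col_mult2[of _ ?n ?n _ ?n, symmetric]) auto
    finally show ?thesis using w by simp
  qed
  have Bi0: "B $$ (i, 0) = (if i = 0 then e else 0)" if "i < ?n" for i
  proof -
    have "B $$ (i, 0) = col B 0 $ i" using B that by auto
    then show ?thesis using that unfolding Bc by auto
  qed
  have Bsym: "B $$ (i, j) = cnj (B $$ (j, i))" if "i < ?n" "j < ?n" for i j
  proof -
    have "mat_adjoint B $$ (i, j) = cnj (B $$ (j, i))" using B that by simp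
    then show ?thesis using Bh by simp
  qed
  have B0i: "B $$ (0, i) = (if i = 0 then e else 0)" if "i < ?n" for i
    using Bsym[of 0 i] Bi0[OF that] Bi0[of 0] that by auto
  have "cnj e = e" using Bsym[of 0 0] Bi0[of 0] by simp
  then have er: "e = complex_of_real (Re e)" by (simp add: complex_eq_iff)
  define A' where "A' = mat n n (\<lambda>(i, j). B $$ (Suc i, Suc j))"
  have A': "A' \<in> carrier_mat n n" by (simp add: A'_def)
  moreover have "mat_adjoint A' = A'"
    by (rule eq_matI) (auto simp: A'_def intro: Bsym[symmetric])
  ultimately obtain P d where P: "unitary n P" and A'P: "A' = P * real_diag n d * mat_adjoint P"
    using Suc.IH by blast
  note p = unitaryD[OF P]
  \<comment> \<open>\<open>F\<close> fixes the first basis vector and acts as \<open>P\<close> on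
    the others, so it diagonalizes \<open>B\<close>; the new eigenvalue \<open>Re e\<close> is put
    in front of the spectrum \<open>d\<close> of the block.\<close>
  define F where "F = four_block_mat (1\<^sub>m 1) (0\<^sub>m 1 n) (0\<^sub>m n 1) P"
  define d' where "d' i = (if i = 0 then Re e else d (i - 1))" for i
  have F: "F \<in> carrier_mat ?n ?n"
    using four_block_carrier_mat[OF one_carrier_mat[of 1] p(1)] by (simp add: F_def)
  have Fa: "mat_adjoint F = four_block_mat (1\<^sub>m 1) (0\<^sub>m 1 n) (0\<^sub>m n 1) (mat_adjoint P)"
    by (rule eq_matI) (use p in \<open>auto simp: F_def\<close>)
  have Dd: "real_diag ?n d' = four_block_mat (complex_of_real (Re e) \<cdot>\<^sub>m 1\<^sub>m 1) (0\<^sub>m 1 n) (0\<^sub>m n 1) (real_diag n d)"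
    by (rule eq_matI) (auto simp: real_diag_def d'_def)
  have "mat_adjoint F * F = 1\<^sub>m ?n"
    unfolding Fa unfolding F_def using p
    by (subst mult_four_block_mat[of _ 1 1 _ n _ n _ _ 1 _ n])
      auto
  then have FU: "unitary ?n F" using F by (intro unitaryI)
  have z: "0\<^sub>m n n + P * real_diag n d * mat_adjoint P = P * real_diag n d * mat_adjoint P"
    using p by (intro left_add_zero_mat[of _ n n]) auto
  have "F * real_diag ?n d' * mat_adjoint F
    = four_block_mat (complex_of_real (Re e) \<cdot>\<^sub>m 1\<^sub>m 1) (0\<^sub>m 1 n) (0\<^sub>m n 1) (P * real_diag n d * mat_adjoint P)"
    unfolding Fa unfolding F_def Dd using p
    by (subst mult_four_block_mat[of _ 1 1 _ n _ n _ _ 1 _ n], simp_all add: z)+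
  also have "\<dots> = B"
    unfolding A'P[symmetric]
  proof (rule eq_matI)
    fix i j assume "i < dim_row B" "j < dim_col B"
    then have "i < ?n" "j < ?n" using B by auto
    then show "four_block_mat (complex_of_real (Re e) \<cdot>\<^sub>m 1\<^sub>m 1) (0\<^sub>m 1 n) (0\<^sub>m n 1) A' $$ (i, j) = B $$ (i, j)"
      using A' Bi0 B0i er by (cases i; cases j) (auto simp: A'_def)
  qed (use A' B in auto)
  finally have BF: "B = F * real_diag ?n d' * mat_adjoint F" by simp
  have "A = W * B * mat_adjoint W" unfolding B_def using unitary_conj_cancel[OF W A] by simp
  also have "\<dots> = (W * F) * real_diag ?n d' * mat_adjoint (W * F)"
    unfolding BF by (rule unitary_conj_mult[OF W FU]) simp
  finally show ?case using unitary_mult[OF W FU] by blast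
qed

section \<open>Scalar entropy inequalities\<close>

text \<open>The graph of the convex function x ln x lies above its tangent at \<open>m\<close>; this
  is ln t <= t - 1 at t = m / x, multiplied by x.\<close>

lemma xlnx_ge_tangent:
  fixes x m :: real
  assumes "0 \<le> x" "0 < m"
  shows "x * ln m + x - m \<le> x * ln x"
proof (cases "x = 0")
  case False
  then have x: "x > 0" using assms by simp
  have "ln (m / x) \<le> m / x - 1" using assms x by (intro ln_le_minus_one) simp
  then have "x * (ln m - ln x) \<le> x * (m / x - 1)"
    using x assms by (simp add: ln_div)
  then show ?thesis using x by (simp add: algebra_simps)
qed (use assms in simp)

lemma xlnx_le: "0 \<le> y \<Longrightarrow> y * ln y \<le> y * (y - 1)" for y :: real
  by (cases "y = 0") (auto intro!: mult_left_mono ln_le_minus_one)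

text \<open>The point of tangency may depend on x. At \<open>sqrt x\<close> the logarithm is half of
  \<open>ln x\<close>, so half of \<open>x * ln x\<close> can be moved to the other side.\<close>

lemma xlnx_ge_sqrt: "0 \<le> x \<Longrightarrow> 2 * x - 2 * sqrt x \<le> x * ln x" for x :: real
proof (cases "x = 0")
  case False
  assume "0 \<le> x"
  then have "x > 0" using False by simp
  then show ?thesis using xlnx_ge_tangent[of x "sqrt x"] by (simp add: ln_sqrt)
qed simp

text \<open>The right-hand side is the chord of m ln m between 1 and 2. The tangent at
  \<open>m\<close> is evaluated at both end points, and the two bounds are added with the weights 2
  - m and m - 1.\<close>

lemma xlnx_le_chord:
  fixes m :: real
  assumes "1 \<le> m" "m \<le> 2"
  shows "m * ln m \<le> 2 * (m - 1) * ln 2"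
proof -
  have "(2 - m) * (ln m + 1 - m) \<le> (2 - m) * 0"
    using xlnx_ge_tangent[of 1 m] assms by (intro mult_left_mono) auto
  moreover have "(m - 1) * (2 * ln m + 2 - m) \<le> (m - 1) * (2 * ln 2)"
    using xlnx_ge_tangent[of 2 m] assms by (intro mult_left_mono) auto
  ultimately show ?thesis by (simp add: algebra_simps)
qed

text \<open>This is just the constant needed for A = 2 and x >= 1 below, and for A = 3 it turns
  \<open>ln 2 / 3\<close> into the rational bound 2/9.\<close>

lemma two_thirds_le_ln_2: "2/3 \<le> ln (2::real)"
proof -
  \<comment> \<open>The bound exp x <= 1 + x + x^2 is too crude at 2/3 itself. At 1/16 it gives
    273/256, whose 32nd power still bounds exp 2, the cube of exp (2/3), by 8.\<close>
  have "exp (1/16) \<le> (273/256 :: real)"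
    using exp_bound[of "1/16 :: real"] by (simp add: power2_eq_square)
  then have "exp (1/16) ^ 32 \<le> (273/256 :: real) ^ 32" by (intro power_mono) auto
  moreover have "exp (1/16) ^ 32 = exp (2/3 :: real) ^ 3"
    unfolding exp_of_nat_mult[symmetric] by simp
  moreover have "(273/256 :: real) ^ 32 \<le> 2 ^ 3" by (simp add: power_divide)
  ultimately have "exp (2/3 :: real) ^ 3 \<le> 2 ^ 3" by linarith
  then have "exp (2/3 :: real) \<le> 2" using power_le_imp_le_base[of "exp (2/3)" 2 "2 :: real"] by (simp only: numeral_3_eq_3 numeral_2_eq_2)
  then show ?thesis by (subst ln_ge_iff) auto
qed

section \<open>The complement inequality for A = 2, A = 3 and A >= 4\<close>

lemma complement_xlnx_two:
  fixes x :: real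
  assumes x: "0 \<le> x" "x \<le> 2"
  shows "(2 - x) * ln (2 - x) - x * ln x \<le> ln 2 / 2 + - (1 + ln 2) * (x - 1)"
proof (cases "1 \<le> x")
  case True
  \<comment> \<open>Here 2 - x <= 1, so the first term is nonpositive. The tangent to x ln x at 2
    has slope 1 + ln 2, so the terms in x cancel and 2/3 <= ln 2 remains.\<close>
  have "(2 - x) * ln (2 - x) \<le> (2 - x) * (1 - x)" using xlnx_le[of "2 - x"] x by simp
  also have "\<dots> \<le> 0" using x True by (intro mult_nonneg_nonpos) auto
  finally have "(2 - x) * ln (2 - x) \<le> 0" .
  then show ?thesis using xlnx_ge_tangent[of x 2] x two_thirds_le_ln_2 by (simp add: algebra_simps)
next
  case False
  \<comment> \<open>The chord contributes the slope -2 ln 2 and the tangent at 1/2 the slope ln 2 -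
    1. Together they make the required slope -(1 + ln 2), and the constants compare by ln 2 <=
    1.\<close>
  have "(2 - x) * ln (2 - x) \<le> 2 * (1 - x) * ln 2" using xlnx_le_chord[of "2 - x"] x False by simp
  moreover have "- (x * ln x) \<le> x * ln 2 + 1/2 - x"
    using xlnx_ge_tangent[of x "1/2"] x by (simp add: ln_div algebra_simps)
  moreover have "ln 2 \<le> (1::real)" using ln_le_minus_one[of 2] by simp
  ultimately show ?thesis by (simp add: algebra_simps)
qed

text \<open>In terms of z = sqrt x, the elementary bounds reduce the claim to two quadratics in z,
  one for each side of x = 1. The slope 27/20 leaves both of them without real roots, whereas the
  tangent slope 3/2 at x = 1 would give the second one roots.\<close>

lemma complement_xlnx_three:
  fixes x :: real
  assumes x: "0 \<le> x" "x \<le> 3"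
  shows "((3 - x) / 2) * ln ((3 - x) / 2) - x * ln x \<le> ln 2 / 3 + - 27/20 * (x - 1)"
proof -
  define z where "z = sqrt x"
  have z: "0 \<le> z" "z^2 = x" using x by (auto simp: z_def)
  have "((3 - x) / 2) * ln ((3 - x) / 2) \<le> ((3 - x) / 2) * ((3 - x) / 2 - 1)"
    using xlnx_le[of "(3 - x) / 2"] x by simp
  moreover have "2 * x - 2 * z \<le> x * ln x" unfolding z_def by (rule xlnx_ge_sqrt[OF x(1)])
  moreover have "((3 - x) / 2) * ((3 - x) / 2 - 1) - 2 * x + 2 * z \<le> 2/9 - 27/20 * (x - 1)"
  proof (cases "x \<le> 1")
    case True
    \<comment> \<open>Bounding \<open>x\<^sup>2\<close> by its chord leaves a quadratic polynomial in \<open>z\<close> without real roots.\<close>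
    have "0 \<le> x * (1 - x)" using True x by simp
    moreover have "0 \<le> (7/5 * (1 - z) - 2/5)^2" by simp
    ultimately show ?thesis unfolding z(2)[symmetric] by (simp add: field_simps power2_eq_square)
  next
    case False
    \<comment> \<open>On this side the product of (3 - x) / 2 and (3 - x) / 2 - 1 is nonpositive and
      is dropped. The square is a multiple of the completed square of the remaining quadratic, up to
      a positive constant.\<close>
    have "0 \<le> (x - 1) * (3 - x)" using False x by simp
    moreover have "0 \<le> (13/20 * (z - 1) - 7/20)^2" by simp
    ultimately show ?thesis unfolding z(2)[symmetric] by (simp add: field_simps power2_eq_square)
  qed
  ultimately show ?thesis using two_thirds_le_ln_2 by linarith
qed

text \<open>The slope -A / (A - 1) is the derivative of the left-hand side at x = 1, where both
  sides vanish. With z = sqrt x and u = (x - 1) / (A - 1), the upper bound for the first term is u^2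
  - u, and the lower bound for x ln x leaves room for (z - 1)^2; so it suffices that u^2 <= (z -
  1)^2.\<close>

lemma complement_xlnx_four:
  fixes x A :: real
  assumes x: "0 \<le> x" "x \<le> A" and A: "4 \<le> A"
  shows "((A - x) / (A - 1)) * ln ((A - x) / (A - 1)) - x * ln x \<le> - (A / (A - 1)) * (x - 1)"
proof -
  define z where "z = sqrt x"
  have z: "0 \<le> z" "z^2 = x" using x by (auto simp: z_def)
  define B where "B = A - 1"
  have B: "B \<ge> 3" using A by (simp add: B_def)
  \<comment> \<open>This is where A >= 4 enters: it gives sqrt x <= A - 2, hence z + 1 <= A - 1, and
    the factor z + 1 of x - 1 is absorbed by the denominator.\<close>
  have "A \<le> (A - 2)^2" using mult_nonneg_nonneg[of "A - 4" "A - 1"] A by (simp add: power2_eq_square algebra_simps)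
  then have "z^2 \<le> (A - 2)^2" using z x by simp
  then have "z \<le> A - 2" using A by (intro power2_le_imp_le[of z]) auto
  then have "z + 1 \<le> B" by (simp add: B_def)
  then have zB: "(z + 1)^2 \<le> B^2" using z by (intro power_mono) auto
  have "(x - 1)^2 = (z - 1)^2 * (z + 1)^2" unfolding z(2)[symmetric] by (simp add: power2_eq_square algebra_simps)
  also have "\<dots> \<le> (z - 1)^2 * B^2" using zB by (intro mult_left_mono) auto
  finally have u: "(x - 1)^2 / B^2 \<le> (z - 1)^2" using B by (simp add: divide_le_eq)
  have y: "(A - x) / (A - 1) = 1 - (x - 1) / B" using B by (simp add: B_def field_simps)
  have "0 \<le> (A - x) / (A - 1)" using x A by simp
  then have "((A - x) / (A - 1)) * ln ((A - x) / (A - 1)) \<le> ((A - x) / (A - 1)) * ((A - x) / (A - 1) - 1)"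
    by (rule xlnx_le)
  also have "\<dots> = (x - 1)^2 / B^2 - (x - 1) / B"
    unfolding y by (simp add: power2_eq_square algebra_simps)
  also have "\<dots> \<le> (z - 1)^2 - (x - 1) / B" using u by simp
  also have "(z - 1)^2 = x - 2 * z + 1" using z by (simp add: power2_eq_square algebra_simps)
  finally have 1: "((A - x) / (A - 1)) * ln ((A - x) / (A - 1)) \<le> x - 2 * z + 1 - (x - 1) / B" .
  have 2: "2 * x - 2 * z \<le> x * ln x" unfolding z_def by (rule xlnx_ge_sqrt[OF x(1)])
  have "A / (A - 1) = 1 + 1 / B" using B by (simp add: B_def field_simps)
  then have "- (A / (A - 1)) * (x - 1) = - (x - 1) - (x - 1) / B" by (simp add: algebra_simps)
  then show ?thesis using 1 2 by simp
qed

text \<open>The constant \<open>c\<close> depends on \<open>A\<close> alone, so the linear term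
  disappears when the inequality is summed over numbers of mean 1. The case A >= 4 has a sharper
  bound, to which the nonnegative \<open>ln 2 / A\<close> is added.\<close>

lemma complement_xlnx:
  assumes "2 \<le> (A :: nat)"
  shows "\<exists>c. \<forall>x. 0 \<le> x \<and> x \<le> real A \<longrightarrow>
    ((real A - x) / (real A - 1)) * ln ((real A - x) / (real A - 1)) - x * ln x \<le> ln 2 / A + c * (x - 1)"
proof -
  consider "A = 2" | "A = 3" | "A \<ge> 4" using assms by linarith
  then show ?thesis
  proof cases
    case 1
    show ?thesis unfolding 1
      by (rule exI[of _ "- (1 + ln 2)"]) (use complement_xlnx_two in auto)
  next
    case 2
    show ?thesis unfolding 2
      by (rule exI[of _ "- 27/20"]) (use complement_xlnx_three in auto)
  next
    case 3
    show ?thesis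
    proof (rule exI[of _ "- (real A / (real A - 1))"], intro allI impI)
      fix x :: real assume x: "0 \<le> x \<and> x \<le> real A"
      have "4 \<le> real A" using 3 by simp
      note complement_xlnx_four[OF conjunct1[OF x] conjunct2[OF x] this]
      also have "- (real A / (real A - 1)) * (x - 1) \<le> ln 2 / A + - (real A / (real A - 1)) * (x - 1)"
        by simp
      finally show "((real A - x) / (real A - 1)) * ln ((real A - x) / (real A - 1)) - x * ln x
        \<le> ln 2 / A + - (real A / (real A - 1)) * (x - 1)" .
    qed
  qed
qed

section \<open>The entropy summand -x log x: scaling, concavity and the complement bound for
  sums\<close>

definition eta :: "real \<Rightarrow> real" where
  "eta x = (if x \<le> 0 then 0 else - (x * log 2 x))"

lemma eta_eq: "0 \<le> x \<Longrightarrow> eta x = - (x * ln x) / ln 2"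
  by (auto simp: eta_def log_def)

lemma eta_nonneg: "x \<le> 1 \<Longrightarrow> 0 \<le> eta x"
  by (auto simp: eta_def mult_nonneg_nonpos)

lemma eta_divide:
  assumes "0 \<le> x" "0 < k"
  shows "eta (x / k) = eta x / k + x / k * log 2 k"
proof (cases "x = 0")
  case False
  then show ?thesis using assms by (simp add: eta_def log_divide field_simps)
qed (simp add: eta_def)

lemma eta_divide_diff:
  assumes "0 \<le> x" "0 \<le> y" "0 < k"
  shows "eta (x / k) - eta (y / k) = (y * ln y - x * ln x) / (ln 2 * k) + (x - y) / k * log 2 k"
  using assms by (simp add: eta_divide) (simp add: eta_eq diff_divide_distrib left_diff_distrib)

lemma eta_le_tangent:
  assumes "0 \<le> x" "0 < m"
  shows "eta x \<le> (m - x - x * ln m) / ln 2"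
  unfolding eta_eq[OF assms(1)] using xlnx_ge_tangent[OF assms] by (intro divide_right_mono) auto

text \<open>Each value is bounded by the tangent at the mean \<open>m\<close>, and the linear terms
  average out. The mean 0, where the slope is infinite, is separate: every point with positive
  weight is then 0.\<close>

lemma eta_jensen:
  assumes "finite I" "\<And>i. i \<in> I \<Longrightarrow> 0 \<le> c i" "\<And>i. i \<in> I \<Longrightarrow> 0 \<le> d i" "sum c I = 1"
  shows "(\<Sum>i\<in>I. c i * eta (d i)) \<le> eta (\<Sum>i\<in>I. c i * d i)"
proof -
  define m where "m = (\<Sum>i\<in>I. c i * d i)"
  have nn: "0 \<le> c i * d i" if "i \<in> I" for i using assms that by simp
  have m0: "m \<ge> 0" unfolding m_def using nn by (rule sum_nonneg)
  show ?thesis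
  proof (cases "m = 0")
    case True
    then have "c i * d i = 0" if "i \<in> I" for i
      using sum_nonneg_eq_0_iff[OF assms(1) nn] that unfolding m_def by auto
    then have "c i * eta (d i) = 0" if "i \<in> I" for i using that by (fastforce simp: eta_def)
    then have "(\<Sum>i\<in>I. c i * eta (d i)) = 0" by simp
    then show ?thesis using True unfolding m_def by (simp add: eta_def)
  next
    case False
    then have m: "m > 0" using m0 by simp
    have "(\<Sum>i\<in>I. c i * eta (d i)) \<le> (\<Sum>i\<in>I. c i * ((m - d i - d i * ln m) / ln 2))"
      using assms m by (intro sum_mono mult_left_mono eta_le_tangent) auto
    also have "\<dots> = (\<Sum>i\<in>I. (m * c i - (1 + ln m) * (c i * d i)) / ln 2)"
      by (intro sum.cong) (auto simp: algebra_simps)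
    also have "\<dots> = (m * sum c I - (1 + ln m) * m) / ln 2"
      by (simp add: sum_subtractf sum_distrib_left m_def flip: sum_divide_distrib)
    also have "\<dots> = eta m" using m assms(4) by (simp add: eta_eq algebra_simps)
    finally show ?thesis unfolding m_def .
  qed
qed

lemma eta_concave:
  assumes "0 \<le> a" "0 \<le> b" "0 \<le> p" "p \<le> 1"
  shows "p * eta a + (1 - p) * eta b \<le> eta (p * a + (1 - p) * b)"
  using eta_jensen[of "UNIV :: bool set" "\<lambda>i. if i then p else 1 - p" "\<lambda>i. if i then a else b"] assms
  by (auto simp: UNIV_bool add.commute)

text \<open>The \<open>w i\<close> are the eigenvalues of the channel output on the maximally mixed
  state, and the complementary arguments are those of \<open>tau\<close>. After scaling by
  \<open>K\<close> the \<open>x i\<close> have mean 1, so a termwise bound with an error linear in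
  \<open>x i - 1\<close> suffices.\<close>

lemma sum_eta_complement:
  assumes A: "2 \<le> (A :: nat)" and K: "0 < (K :: nat)"
    and w: "\<And>i. i < K \<Longrightarrow> 0 \<le> w i" "(\<Sum>i<K. w i) = 1"
    and y: "\<And>i. i < K \<Longrightarrow> 0 \<le> (A / K - w i) / (real A - 1)"
  shows "(\<Sum>i<K. eta (w i)) \<le> (\<Sum>i<K. eta ((A / K - w i) / (real A - 1))) + 1 / A"
proof -
  obtain c where c: "\<And>x. 0 \<le> x \<Longrightarrow> x \<le> real A \<Longrightarrow>
    ((real A - x) / (real A - 1)) * ln ((real A - x) / (real A - 1)) - x * ln x \<le> ln 2 / A + c * (x - 1)"
    using complement_xlnx[OF A] by blast
  define x where "x i = K * w i" for i
  \<comment> \<open>\<open>b\<close> collects both coefficients of \<open>x i - 1\<close>: the one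
    from the scalar inequality, and the one from the logarithm of the scaling factor
    \<open>K\<close>, where x - y = A / (A - 1) * (x - 1).\<close>
  define b where "b = c / (K * ln 2) + A / (real A - 1) * log 2 K / K"
  have "eta (w i) - eta ((A / K - w i) / (real A - 1)) \<le> 1 / (A * K) + b * (x i - 1)" if i: "i < K" for i
  proof -
    have x0: "0 \<le> x i" using w(1)[OF i] by (simp add: x_def)
    have wx: "w i = x i / K" and yx: "(A / K - w i) / (real A - 1) = (real A - x i) / (real A - 1) / K"
      using K by (auto simp: x_def field_simps)
    \<comment> \<open>Nonnegativity of the complementary eigenvalue forces \<open>x i <= A\<close>,
      the range in which the scalar inequality holds.\<close>
    have "0 \<le> ((real A - x i) / (real A - 1) / K) * K"
      using y[OF i] unfolding yx by (intro mult_nonneg_nonneg) auto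
    then have y0: "0 \<le> (real A - x i) / (real A - 1)" using K by simp
    then have xA: "x i \<le> A" using A by (simp add: zero_le_divide_iff)
    have "eta (w i) - eta ((A / K - w i) / (real A - 1))
      = (((real A - x i) / (real A - 1)) * ln ((real A - x i) / (real A - 1)) - x i * ln (x i)) / (ln 2 * K)
        + (x i - (real A - x i) / (real A - 1)) / K * log 2 K"
      unfolding yx unfolding wx by (rule eta_divide_diff[OF x0 y0]) (use K in simp)
    also have "x i - (real A - x i) / (real A - 1) = A / (real A - 1) * (x i - 1)"
      using A by (simp add: field_simps)
    also have "(((real A - x i) / (real A - 1)) * ln ((real A - x i) / (real A - 1)) - x i * ln (x i)) / (ln 2 * K)
       \<le> (ln 2 / A + c * (x i - 1)) / (ln 2 * K)"
      using c[OF x0 xA] by (intro divide_right_mono) auto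
    also have "(ln 2 / A + c * (x i - 1)) / (ln 2 * K) + A / (real A - 1) * (x i - 1) / K * log 2 K
      = 1 / (A * K) + b * (x i - 1)"
      unfolding b_def by (simp add: add_divide_distrib distrib_right distrib_left ac_simps)
    finally show ?thesis by simp
  qed
  then have "(\<Sum>i<K. eta (w i) - eta ((A / K - w i) / (real A - 1))) \<le> (\<Sum>i<K. 1 / (A * K) + b * (x i - 1))"
    by (intro sum_mono) auto
  also have "\<dots> = 1 / A + b * ((\<Sum>i<K. x i) - K)"
    using K by (simp add: sum.distrib sum_subtractf flip: sum_distrib_left)
  also have "(\<Sum>i<K. x i) = K" using w(2) by (simp add: x_def flip: sum_distrib_left)
  finally show ?thesis by (simp add: sum_subtractf)
qed

section \<open>Von Neumann entropy of positive semidefinite matrices\<close>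

lemma proots_linear_factors: "proots (\<Prod>a\<leftarrow>as. [:- a, 1:]) = mset (as :: complex list)"
proof (induction as)
  case (Cons a as)
  have "(\<Prod>a\<leftarrow>as. [:- a, 1:]) \<noteq> 0" by (auto simp: prod_list_zero_iff)
  then have "proots ([:- a, 1:] * (\<Prod>a\<leftarrow>as. [:- a, 1:])) = proots [:- a, 1:] + mset as"
    using Cons by (subst proots_mult) auto
  then show ?case by simp
qed simp

text \<open>Entropy is defined through the roots of the characteristic polynomial, which similarity
  preserves; for a diagonal matrix they are the diagonal entries with multiplicity.\<close>

lemma entropy_eq_sum_eta:
  assumes P: "unitary n P"
  shows "entropy (P * real_diag n d * mat_adjoint P) = (\<Sum>i<n. eta (d i))"
proof -
  note p = unitaryD[OF P]
  have "similar_mat (P * real_diag n d * mat_adjoint P) (real_diag n d)"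
    unfolding similar_mat_def similar_mat_wit_def Let_def using p
    by (intro exI[of _ P] exI[of _ "mat_adjoint P"]) auto
  then have "char_poly (P * real_diag n d * mat_adjoint P) = char_poly (real_diag n d)"
    by (rule char_poly_similar)
  also have "\<dots> = (\<Prod>a\<leftarrow>diag_mat (real_diag n d). [:- a, 1:])"
    by (rule char_poly_upper_triangular[of _ n]) (auto simp: real_diag_def)
  also have "diag_mat (real_diag n d) = map (\<lambda>i. complex_of_real (d i)) [0..<n]"
    by (auto simp: diag_mat_def real_diag_def)
  finally have "proots (char_poly (P * real_diag n d * mat_adjoint P))
    = mset (map (\<lambda>i. complex_of_real (d i)) [0..<n])"
    by (simp only: proots_linear_factors)
  then have "entropy (P * real_diag n d * mat_adjoint P)
    = - (\<Sum>i<n. if d i \<le> 0 then 0 else d i * log 2 (d i))"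
    unfolding entropy_def
    by (simp add: Let_def multiset.map_comp comp_def sum_unfold_sum_mset atLeast0LessThan cong: if_cong)
  also have "\<dots> = (\<Sum>i<n. eta (d i))"
    unfolding sum_negf[symmetric] by (intro sum.cong) (auto simp: eta_def)
  finally show ?thesis .
qed

section \<open>Positive semidefinite matrices, their spectra and traces\<close>

definition psd :: "nat \<Rightarrow> complex mat \<Rightarrow> bool" where
  "psd n M \<longleftrightarrow> M \<in> carrier_mat n n \<and> mat_adjoint M = M \<and>
     (\<forall>v\<in>carrier_vec n. 0 \<le> Re (conjugate v \<bullet> (M *\<^sub>v v)))"

lemma density_iff_psd: "density n M \<longleftrightarrow> psd n M \<and> mtrace M = 1"
  by (auto simp: density_def psd_def)

lemma psdD:
  assumes "psd n M"
  shows "M \<in> carrier_mat n n" "mat_adjoint M = M"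
    "\<And>v. v \<in> carrier_vec n \<Longrightarrow> 0 \<le> Re (conjugate v \<bullet> (M *\<^sub>v v))"
  using assms by (auto simp: psd_def)

lemma quadratic_form_sum:
  assumes "M \<in> carrier_mat n n" "v \<in> carrier_vec n"
  shows "conjugate v \<bullet> (M *\<^sub>v v) = (\<Sum>i<n. \<Sum>j<n. cnj (v $ i) * M $$ (i, j) * v $ j)"
  using assms by (auto simp: scalar_prod_def atLeast0LessThan sum_distrib_left mult.assoc)

lemma adjoint_quadratic_form:
  fixes M C :: "complex mat"
  assumes M: "M \<in> carrier_mat n n" and C: "C \<in> carrier_mat n n" and v: "v \<in> carrier_vec n"
  shows "conjugate v \<bullet> ((C * M * mat_adjoint C) *\<^sub>v v)
    = conjugate (mat_adjoint C *\<^sub>v v) \<bullet> (M *\<^sub>v (mat_adjoint C *\<^sub>v v))"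
proof -
  define u where "u = M *\<^sub>v (mat_adjoint C *\<^sub>v v)"
  have u: "u \<in> carrier_vec n" using M C v by (simp add: u_def)
  have "conjugate v \<bullet> ((C * M * mat_adjoint C) *\<^sub>v v) = conjugate v \<bullet> (C *\<^sub>v u)"
    unfolding u_def using M C v by (simp add: assoc_mult_mat_vec[of _ n n _ n])
  also have "\<dots> = (\<Sum>i<n. \<Sum>j<n. cnj (v $ i) * C $$ (i, j) * u $ j)"
    using C u v by (auto simp: scalar_prod_def atLeast0LessThan sum_distrib_left mult.assoc)
  also have "\<dots> = (\<Sum>j<n. \<Sum>i<n. cnj (v $ i) * C $$ (i, j) * u $ j)" by (rule sum.swap)
  also have "\<dots> = conjugate (mat_adjoint C *\<^sub>v v) \<bullet> u"
    using C u v by (auto simp: scalar_prod_def atLeast0LessThan sum_distrib_right sum_distrib_left ac_simps intro!: sum.cong)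
  finally show ?thesis by (simp add: u_def)
qed

lemma psd_conj:
  assumes M: "psd n M" and C: "C \<in> carrier_mat n n"
  shows "psd n (C * M * mat_adjoint C)"
  unfolding psd_def
proof (intro conjI ballI)
  note m = psdD[OF M]
  show "C * M * mat_adjoint C \<in> carrier_mat n n" using m C by auto
  show "mat_adjoint (C * M * mat_adjoint C) = C * M * mat_adjoint C"
    using m(1,2) C by (simp add: mat_adjoint_mult[of _ n n _ n] assoc_mult_mat[of _ n n _ n _ n])
  fix v :: "complex vec" assume v: "v \<in> carrier_vec n"
  then have "mat_adjoint C *\<^sub>v v \<in> carrier_vec n" using C by auto
  then show "0 \<le> Re (conjugate v \<bullet> (C * M * mat_adjoint C *\<^sub>v v))"
    unfolding adjoint_quadratic_form[OF m(1) C v] by (rule m(3))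
qed

lemma psd_diag_nonneg:
  assumes M: "psd n M" and i: "i < n"
  shows "0 \<le> Re (M $$ (i, i))"
proof -
  have "conjugate (unit_vec n i) \<bullet> (M *\<^sub>v unit_vec n i)
    = (\<Sum>k<n. if k = i then (\<Sum>j<n. if j = i then M $$ (i, j) else 0) else 0)"
    unfolding quadratic_form_sum[OF psdD(1)[OF M] unit_vec_carrier] using i
    by (intro sum.cong) (auto intro!: sum.cong simp: if_distrib cong: if_cong)
  also have "\<dots> = M $$ (i, i)" using i by simp
  finally show ?thesis using psdD(3)[OF M unit_vec_carrier[of n i]] by simp
qed

lemma psd_real_diag_iff: "psd n (real_diag n d) \<longleftrightarrow> (\<forall>i<n. 0 \<le> d i)"
proof
  assume "psd n (real_diag n d)"
  then show "\<forall>i<n. 0 \<le> d i" using psd_diag_nonneg[of n "real_diag n d"] by (auto simp: real_diag_def)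
next
  assume d: "\<forall>i<n. 0 \<le> d i"
  have "conjugate v \<bullet> (real_diag n d *\<^sub>v v) = complex_of_real (\<Sum>i<n. d i * (cmod (v $ i))\<^sup>2)"
    if v: "v \<in> carrier_vec n" for v
  proof -
    have "conjugate v \<bullet> (real_diag n d *\<^sub>v v)
      = (\<Sum>i<n. \<Sum>j<n. if j = i then d i * (v $ i * cnj (v $ i)) else 0)"
      unfolding quadratic_form_sum[OF real_diag_carrier v]
      by (intro sum.cong) (auto simp: real_diag_def)
    also have "\<dots> = (\<Sum>i<n. d i * (v $ i * cnj (v $ i)))" by (simp add: sum.delta)
    finally show ?thesis by (simp flip: complex_norm_square)
  qed
  moreover have "mat_adjoint (real_diag n d) = real_diag n d"
    by (rule eq_matI) (auto simp: real_diag_def)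
  ultimately show "psd n (real_diag n d)"
    using d by (auto simp: psd_def intro!: sum_nonneg)
qed

lemma unitary_conj_diag:
  assumes "unitary n P" "M = P * D * mat_adjoint P" "D \<in> carrier_mat n n"
  shows "mat_adjoint P * M * P = D"
  using unitary_conj_cancel[OF unitary_adjoint[OF assms(1)] assms(3)] assms(2) by simp

text \<open>The diagonalization is arbitrary here, so that the result also applies to
  \<open>tau\<close> written in the eigenbasis of another state.\<close>

lemma psd_conj_real_diag_nonneg:
  assumes P: "unitary n P" and M: "psd n (P * real_diag n d * mat_adjoint P)" and i: "i < n"
  shows "0 \<le> d i"
proof -
  have "psd n (mat_adjoint P * (P * real_diag n d * mat_adjoint P) * mat_adjoint (mat_adjoint P))"
    using unitaryD[OF P] by (intro psd_conj[OF M]) auto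
  then have "psd n (real_diag n d)" using unitary_conj_diag[OF P refl real_diag_carrier] by simp
  then show ?thesis using i by (auto simp: psd_real_diag_iff)
qed

lemma psd_diagonalization:
  assumes M: "psd n M"
  obtains P d where "unitary n P" "M = P * real_diag n d * mat_adjoint P" "\<And>i. i < n \<Longrightarrow> 0 \<le> d i"
proof -
  obtain P d where P: "unitary n P" "M = P * real_diag n d * mat_adjoint P"
    using hermitian_diagonalization[OF psdD(1,2)[OF M]] by blast
  then show ?thesis using that[OF P] psd_conj_real_diag_nonneg[OF P(1)] M by blast
qed

lemma mtrace_mult_commute:
  assumes "A \<in> carrier_mat n m" "B \<in> carrier_mat m n"
  shows "mtrace (A * B) = mtrace (B * A)"
proof -
  have "mtrace (A * B) = (\<Sum>i<n. \<Sum>l<m. A $$ (i, l) * B $$ (l, i))"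
    unfolding mtrace_def using assms
    by (auto simp del: index_mult_mat(1) simp: index_mat_mult_sum[OF assms] intro!: sum.cong)
  also have "\<dots> = (\<Sum>l<m. \<Sum>i<n. B $$ (l, i) * A $$ (i, l))"
    by (subst sum.swap) (simp add: mult.commute)
  also have "\<dots> = mtrace (B * A)"
    unfolding mtrace_def using assms
    by (auto simp del: index_mult_mat(1) simp: index_mat_mult_sum[OF assms(2,1)] intro!: sum.cong)
  finally show ?thesis .
qed

lemma mtrace_unitary_conj:
  assumes U: "unitary n U" and M: "M \<in> carrier_mat n n"
  shows "mtrace (U * M * mat_adjoint U) = mtrace M"
proof -
  note u = unitaryD[OF U]
  have "mtrace (U * M * mat_adjoint U) = mtrace (mat_adjoint U * (U * M))"
    using u M by (intro mtrace_mult_commute[of _ n n]) auto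
  also have "mat_adjoint U * (U * M) = (mat_adjoint U * U) * M"
    using u(1,2) M by (simp add: assoc_mult_mat[of _ n n _ n _ n])
  finally show ?thesis using u M by simp
qed

lemma mtrace_real_diag: "mtrace (real_diag n d) = complex_of_real (\<Sum>i<n. d i)"
  by (simp add: mtrace_def real_diag_def)

lemma mtrace_diagonalized:
  "unitary n P \<Longrightarrow> mtrace (P * real_diag n d * mat_adjoint P) = complex_of_real (\<Sum>i<n. d i)"
  by (simp add: mtrace_unitary_conj mtrace_real_diag)

text \<open>All eigenvalues lie in [0, 1]. This provides the lower bounds that make the infima in
  \<open>Smin\<close> meaningful.\<close>

lemma entropy_nonneg:
  assumes "density n M"
  shows "0 \<le> entropy M"
proof -
  from assms have M: "psd n M" and t: "mtrace M = 1" by (auto simp: density_iff_psd)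
  obtain P d where P: "unitary n P" "M = P * real_diag n d * mat_adjoint P" "\<And>i. i < n \<Longrightarrow> 0 \<le> d i"
    using psd_diagonalization[OF M] by blast
  have "complex_of_real (\<Sum>i<n. d i) = 1" using t mtrace_diagonalized[OF P(1)] P(2) by simp
  then have s: "(\<Sum>i<n. d i) = 1" using of_real_eq_1_iff by blast
  have "d i \<le> 1" if "i < n" for i
    using member_le_sum[of i "{..<n}" d] P(3) that s by auto
  then show ?thesis unfolding P(2) entropy_eq_sum_eta[OF P(1)]
    by (intro sum_nonneg eta_nonneg) auto
qed

text \<open>Nonnegative eigenvalues with sum 0 all vanish. This settles inputs without weight on
  S_0, whose corner block cannot be normalized.\<close>

lemma psd_mtrace_zero:
  assumes M: "psd n M" and t: "mtrace M = 0"
  shows "M = 0\<^sub>m n n"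
proof -
  obtain P d where P: "unitary n P" "M = P * real_diag n d * mat_adjoint P" "\<And>i. i < n \<Longrightarrow> 0 \<le> d i"
    using psd_diagonalization[OF M] by blast
  have "(\<Sum>i<n. d i) = 0" using t mtrace_diagonalized[OF P(1)] P(2) of_real_eq_0_iff by metis
  then have "d i = 0" if "i < n" for i
    using sum_nonneg_eq_0_iff[of "{..<n}" d] P(3) that by auto
  then have "real_diag n d = 0\<^sub>m n n" by (intro eq_matI) (auto simp: real_diag_def)
  then show ?thesis using P(2) unitaryD[OF P(1)] by simp
qed

section \<open>Diagonals in other bases and concavity of the entropy\<close>

lemma unitary_row_norm:
  assumes W: "unitary n W" and j: "j < n"
  shows "(\<Sum>i<n. (cmod (W $$ (j, i)))\<^sup>2) = 1"
proof -
  note w = unitaryD[OF W]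
  have "complex_of_real (\<Sum>i<n. (cmod (W $$ (j, i)))\<^sup>2) = (\<Sum>i<n. W $$ (j, i) * mat_adjoint W $$ (i, j))"
    using w(1) j by (auto simp flip: complex_norm_square intro!: sum.cong)
  also have "\<dots> = (W * mat_adjoint W) $$ (j, j)"
    by (rule index_mat_mult_sum[OF w(1,2) j j, symmetric])
  also have "\<dots> = 1" using w j by simp
  finally show ?thesis using of_real_eq_1_iff by blast
qed

lemma unitary_col_norm:
  assumes W: "unitary n W" and i: "i < n"
  shows "(\<Sum>j<n. (cmod (W $$ (j, i)))\<^sup>2) = 1"
proof -
  have "(\<Sum>j<n. (cmod (W $$ (j, i)))\<^sup>2) = (\<Sum>j<n. (cmod (mat_adjoint W $$ (i, j)))\<^sup>2)"
    using unitaryD(1)[OF W] i by (intro sum.cong) auto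
  then show ?thesis using unitary_row_norm[OF unitary_adjoint[OF W] i] by simp
qed

lemma conj_real_diag_diag:
  assumes W: "W \<in> carrier_mat n n" and j: "j < n"
  shows "(W * real_diag n d * mat_adjoint W) $$ (j, j) = complex_of_real (\<Sum>i<n. (cmod (W $$ (j, i)))\<^sup>2 * d i)"
proof -
  have "(W * real_diag n d) $$ (j, l) = W $$ (j, l) * d l" if "l < n" for l
  proof -
    have "(W * real_diag n d) $$ (j, l) = (\<Sum>i<n. if i = l then W $$ (j, i) * d i else 0)"
      unfolding index_mat_mult_sum[OF W real_diag_carrier j that]
      using that by (intro sum.cong) (auto simp: real_diag_def)
    then show ?thesis using that by (simp add: sum.delta)
  qed
  moreover have "(W * real_diag n d * mat_adjoint W) $$ (j, j)
    = (\<Sum>l<n. (W * real_diag n d) $$ (j, l) * mat_adjoint W $$ (l, j))"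
    using W j by (intro index_mat_mult_sum[of _ n n _ n]) auto
  ultimately have "(W * real_diag n d * mat_adjoint W) $$ (j, j)
    = (\<Sum>l<n. (W $$ (j, l) * cnj (W $$ (j, l))) * d l)"
    using W j by (auto intro!: sum.cong)
  then show ?thesis by (simp flip: complex_norm_square)
qed

text \<open>The diagonal of a Hermitian matrix in any orthonormal basis is the image of its spectrum
  under a doubly stochastic matrix.\<close>

lemma entropy_le_diagonal:
  assumes M: "psd n M" and V: "unitary n V"
  shows "entropy M \<le> (\<Sum>j<n. eta (Re ((mat_adjoint V * M * V) $$ (j, j))))"
proof -
  obtain P d where P: "unitary n P" "M = P * real_diag n d * mat_adjoint P" "\<And>i. i < n \<Longrightarrow> 0 \<le> d i"
    using psd_diagonalization[OF M] by blast
  \<comment> \<open>The squared moduli of the entries of \<open>W\<close>, the overlaps between the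
    basis \<open>V\<close> and the eigenbasis \<open>P\<close>, form the doubly stochastic
    matrix.\<close>
  define W where "W = mat_adjoint V * P"
  have W: "unitary n W" unfolding W_def by (intro unitary_mult unitary_adjoint V P)
  have "mat_adjoint V * M * V = W * real_diag n d * mat_adjoint W"
    using unitary_conj_mult[OF unitary_adjoint[OF V] P(1) real_diag_carrier, of d]
    unfolding P(2) W_def by simp
  then have diag: "Re ((mat_adjoint V * M * V) $$ (j, j)) = (\<Sum>i<n. (cmod (W $$ (j, i)))\<^sup>2 * d i)" if "j < n" for j
    using conj_real_diag_diag[OF unitaryD(1)[OF W] that, of d] by simp
  \<comment> \<open>Column sums equal to 1 insert the weights; row sums equal to 1 then allow Jensen
    for each j.\<close>
  have "entropy M = (\<Sum>i<n. (\<Sum>j<n. (cmod (W $$ (j, i)))\<^sup>2) * eta (d i))"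
    unfolding P(2) entropy_eq_sum_eta[OF P(1)] by (simp add: unitary_col_norm[OF W])
  also have "\<dots> = (\<Sum>j<n. \<Sum>i<n. (cmod (W $$ (j, i)))\<^sup>2 * eta (d i))"
    unfolding sum_distrib_right by (rule sum.swap)
  also have "\<dots> \<le> (\<Sum>j<n. eta (\<Sum>i<n. (cmod (W $$ (j, i)))\<^sup>2 * d i))"
    using unitary_row_norm[OF W] P(3) by (intro sum_mono eta_jensen) auto
  also have "\<dots> = (\<Sum>j<n. eta (Re ((mat_adjoint V * M * V) $$ (j, j))))"
    by (intro sum.cong) (auto simp: diag)
  finally show ?thesis .
qed

lemma psd_add_smult:
  assumes A: "psd n A" and B: "psd n B" and "0 \<le> a" "0 \<le> b"
  shows "psd n (complex_of_real a \<cdot>\<^sub>m A + complex_of_real b \<cdot>\<^sub>m B)" (is "psd n ?M")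
  unfolding psd_def
proof (intro conjI ballI)
  note a = psdD[OF A] and b = psdD[OF B]
  show M: "?M \<in> carrier_mat n n" using a b by auto
  have "cnj (A $$ (j, i)) = A $$ (i, j)" "cnj (B $$ (j, i)) = B $$ (i, j)" if "i < n" "j < n" for i j
    using arg_cong[OF a(2), of "\<lambda>X. X $$ (i, j)"] arg_cong[OF b(2), of "\<lambda>X. X $$ (i, j)"] a(1) b(1) that by auto
  then show "mat_adjoint ?M = ?M" using a(1) b(1) by (intro eq_matI) auto
  fix v :: "complex vec" assume v: "v \<in> carrier_vec n"
  have "conjugate v \<bullet> (?M *\<^sub>v v)
    = complex_of_real a * (conjugate v \<bullet> (A *\<^sub>v v)) + complex_of_real b * (conjugate v \<bullet> (B *\<^sub>v v))"
    unfolding quadratic_form_sum[OF M v] quadratic_form_sum[OF a(1) v] quadratic_form_sum[OF b(1) v]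
      sum_distrib_left sum.distrib[symmetric]
    using a(1) b(1) by (intro sum.cong) (auto simp: algebra_simps)
  then show "0 \<le> Re (conjugate v \<bullet> (?M *\<^sub>v v))"
    using a(3)[OF v] b(3)[OF v] assms by simp
qed

text \<open>In an eigenbasis of the mixture, its eigenvalues are the mixtures of the diagonals of
  \<open>A\<close> and \<open>B\<close>. Scalar concavity applies entrywise, and the entropies of
  \<open>A\<close> and \<open>B\<close> are at most those of their diagonals.\<close>

lemma entropy_concave:
  assumes A: "psd n A" and B: "psd n B" and p: "0 \<le> p" "p \<le> 1"
  shows "p * entropy A + (1 - p) * entropy B
    \<le> entropy (complex_of_real p \<cdot>\<^sub>m A + complex_of_real (1 - p) \<cdot>\<^sub>m B)"
proof -
  define M where "M = complex_of_real p \<cdot>\<^sub>m A + complex_of_real (1 - p) \<cdot>\<^sub>m B"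
  have "psd n M" unfolding M_def using p by (intro psd_add_smult A B) auto
  then obtain V d where V: "unitary n V" "M = V * real_diag n d * mat_adjoint V"
    using psd_diagonalization by blast
  note v = unitaryD[OF V(1)]
  define a where "a j = Re ((mat_adjoint V * A * V) $$ (j, j))" for j
  define b where "b j = Re ((mat_adjoint V * B * V) $$ (j, j))" for j
  have "psd n (mat_adjoint V * A * mat_adjoint (mat_adjoint V))" "psd n (mat_adjoint V * B * mat_adjoint (mat_adjoint V))"
    using v by (intro psd_conj A B; simp)+
  then have ab: "0 \<le> a j" "0 \<le> b j" if "j < n" for j
    unfolding a_def b_def using psd_diag_nonneg that by auto
  have "mat_adjoint V * M * V
    = complex_of_real p \<cdot>\<^sub>m (mat_adjoint V * A * V) + complex_of_real (1 - p) \<cdot>\<^sub>m (mat_adjoint V * B * V)"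
    unfolding M_def using v(1,2) psdD(1)[OF A] psdD(1)[OF B]
    by (simp add: mult_add_distrib_mat[of _ n n _ n] add_mult_distrib_mat[of _ n n _ _ n]
        mult_smult_distrib[of _ n n _ n] mult_smult_assoc_mat[of _ n n _ n])
  then have dj: "d j = p * a j + (1 - p) * b j" if "j < n" for j
    using arg_cong[OF unitary_conj_diag[OF V real_diag_carrier], of "\<lambda>X. Re (X $$ (j, j))"]
      that v(1,2) psdD(1)[OF A] psdD(1)[OF B]
    by (simp add: a_def b_def real_diag_def)
  have "p * entropy A + (1 - p) * entropy B \<le> p * (\<Sum>j<n. eta (a j)) + (1 - p) * (\<Sum>j<n. eta (b j))"
    unfolding a_def b_def using p
    by (intro add_mono mult_left_mono entropy_le_diagonal[OF A V(1)] entropy_le_diagonal[OF B V(1)]) auto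
  also have "\<dots> = (\<Sum>j<n. p * eta (a j) + (1 - p) * eta (b j))"
    by (simp add: sum.distrib sum_distrib_left)
  also have "\<dots> \<le> (\<Sum>j<n. eta (d j))"
    using ab p by (intro sum_mono) (auto simp: dj eta_concave)
  also have "\<dots> = entropy M" unfolding V(2) entropy_eq_sum_eta[OF V(1)] ..
  finally show ?thesis unfolding M_def .
qed

section \<open>Partial trace and ancilla embedding\<close>

lemma sum_lessThan_mult:
  fixes f :: "nat \<Rightarrow> 'a::comm_monoid_add"
  shows "(\<Sum>r<K * B. f r) = (\<Sum>p<K. \<Sum>q<B. f (p * B + q))"
proof -
  have "sum f {p * B..<p * B + B} = (\<Sum>q<B. f (p * B + q))" for p
    using sum.shift_bounds_nat_ivl[of f 0 "p * B" B] by (simp add: atLeast0LessThan add.commute)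
  then show ?thesis using sum.nat_group[of f B K] by simp
qed

lemma pair_index_less: "p < K \<Longrightarrow> q < B \<Longrightarrow> p * B + q < K * (B::nat)"
  by (metis add_less_cancel_left less_le_trans mult_le_mono1 Suc_leI mult_Suc add.commute)

text \<open>This is \<open>A\<close> tensored with the identity on B, with index
  \<open>p * B + q\<close> for the pair (p, q). It respects products and adjoints, so it lifts a
  diagonalization of the reduced state to one of the output of \<open>N_B\<close>.\<close>

definition kron_one :: "nat \<Rightarrow> nat \<Rightarrow> complex mat \<Rightarrow> complex mat" where
  "kron_one K B A = mat (K * B) (K * B)
     (\<lambda>(r, c). if r mod B = c mod B then A $$ (r div B, c div B) else 0)"

lemma kron_one_carrier [simp]: "kron_one K B A \<in> carrier_mat (K * B) (K * B)"
  by (simp add: kron_one_def)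

lemma kron_one_mult:
  assumes A: "A \<in> carrier_mat K K" and C: "C \<in> carrier_mat K K"
  shows "kron_one K B A * kron_one K B C = kron_one K B (A * C)"
proof (rule eq_matI)
  fix r c assume "r < dim_row (kron_one K B (A * C))" "c < dim_col (kron_one K B (A * C))"
  then have rc: "r < K * B" "c < K * B" by (auto simp: kron_one_def)
  then have B: "B > 0" by (cases B) auto
  have d: "r div B < K" "c div B < K" using rc by (auto simp: less_mult_imp_div_less)
  have "(kron_one K B A * kron_one K B C) $$ (r, c)
    = (\<Sum>p<K. \<Sum>q<B. kron_one K B A $$ (r, p * B + q) * kron_one K B C $$ (p * B + q, c))"
    by (subst index_mat_mult_sum[OF kron_one_carrier kron_one_carrier rc]) (rule sum_lessThan_mult)
  also have "\<dots> = (\<Sum>p<K. \<Sum>q<B. if q = r mod B then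
      (if r mod B = c mod B then A $$ (r div B, p) * C $$ (p, c div B) else 0) else 0)"
    using rc by (intro sum.cong) (auto simp: kron_one_def pair_index_less)
  also have "\<dots> = (\<Sum>p<K. if r mod B = c mod B then A $$ (r div B, p) * C $$ (p, c div B) else 0)"
    using B by (intro sum.cong) (auto simp: sum.delta)
  also have "\<dots> = kron_one K B (A * C) $$ (r, c)"
    using rc index_mat_mult_sum[OF A C d] by (simp add: kron_one_def)
  finally show "(kron_one K B A * kron_one K B C) $$ (r, c) = kron_one K B (A * C) $$ (r, c)" .
qed (auto simp: kron_one_def)

lemma kron_one_adjoint:
  "A \<in> carrier_mat K K \<Longrightarrow> mat_adjoint (kron_one K B A) = kron_one K B (mat_adjoint A)"
  by (rule eq_matI) (auto simp: kron_one_def less_mult_imp_div_less)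

lemma div_mod_eq_iff: "r div B = c div B \<and> r mod B = c mod B \<longleftrightarrow> r = (c :: nat)"
  by (metis div_mult_mod_eq)

lemma kron_one_one: "kron_one K B (1\<^sub>m K) = 1\<^sub>m (K * B)"
  by (rule eq_matI) (auto simp: kron_one_def less_mult_imp_div_less dest: div_mod_eq_iff[THEN iffD1, OF conjI])

lemma kron_one_real_diag: "kron_one K B (real_diag K d) = real_diag (K * B) (\<lambda>r. d (r div B))"
  by (rule eq_matI)
    (auto simp: kron_one_def real_diag_def less_mult_imp_div_less dest: div_mod_eq_iff[THEN iffD1, OF conjI])

lemma kron_one_unitary:
  assumes "unitary K P"
  shows "unitary (K * B) (kron_one K B P)"
  using unitaryD[OF assms] by (intro unitaryI) (auto simp: kron_one_adjoint kron_one_mult kron_one_one)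

lemma ptrace_B_carrier [simp]: "ptrace_B K B Y \<in> carrier_mat K K"
  by (simp add: ptrace_B_def)

lemma N_B_eq_kron_one: "N_B K B Y = kron_one K B ((1 / complex_of_nat B) \<cdot>\<^sub>m ptrace_B K B Y)"
  by (rule eq_matI) (auto simp: N_B_def kron_one_def ptrace_B_def less_mult_imp_div_less)

lemma smult_conj_real_diag:
  assumes P: "P \<in> carrier_mat n n"
  shows "complex_of_real c \<cdot>\<^sub>m (P * real_diag n d * mat_adjoint P)
    = P * real_diag n (\<lambda>i. c * d i) * mat_adjoint P"
proof -
  have "real_diag n (\<lambda>i. c * d i) = complex_of_real c \<cdot>\<^sub>m real_diag n d"
    by (rule eq_matI) (auto simp: real_diag_def)
  then show ?thesis
    using P by (simp add: mult_smult_distrib[of _ n n _ n] mult_smult_assoc_mat[of _ n n _ n])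
qed

text \<open>The output has the eigenvalues of the reduced state divided by \<open>B\<close>, each
  repeated \<open>B\<close> times. Since they originally sum to 1, the scaling contributes exactly
  \<open>log 2 B\<close>.\<close>

lemma entropy_N_B:
  assumes B: "0 < B" and Y: "density K (ptrace_B K B Y)"
  shows "entropy (N_B K B Y) = entropy (ptrace_B K B Y) + log 2 B"
proof -
  from Y have psd: "psd K (ptrace_B K B Y)" and t: "mtrace (ptrace_B K B Y) = 1"
    by (auto simp: density_iff_psd)
  obtain P d where P: "unitary K P" "ptrace_B K B Y = P * real_diag K d * mat_adjoint P"
      "\<And>i. i < K \<Longrightarrow> 0 \<le> d i"
    using psd_diagonalization[OF psd] by blast
  note p = unitaryD[OF P(1)]
  have "complex_of_real (\<Sum>i<K. d i) = 1" using t mtrace_diagonalized[OF P(1)] P(2) by simp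
  then have s: "(\<Sum>i<K. d i) = 1" using of_real_eq_1_iff by blast
  have "(1 / complex_of_nat B) \<cdot>\<^sub>m ptrace_B K B Y = P * real_diag K (\<lambda>i. (1 / B) * d i) * mat_adjoint P"
    unfolding P(2) smult_conj_real_diag[OF p(1), symmetric] by simp
  moreover have "kron_one K B (P * real_diag K (\<lambda>i. (1 / B) * d i) * mat_adjoint P)
    = kron_one K B P * real_diag (K * B) (\<lambda>r. (1 / B) * d (r div B)) * mat_adjoint (kron_one K B P)"
    unfolding kron_one_real_diag[of K B "\<lambda>i. (1 / B) * d i", symmetric]
    using p by (simp add: kron_one_adjoint kron_one_mult)
  ultimately have "N_B K B Y = kron_one K B P * real_diag (K * B) (\<lambda>r. (1 / B) * d (r div B)) * mat_adjoint (kron_one K B P)"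
    unfolding N_B_eq_kron_one by simp
  then have "entropy (N_B K B Y) = (\<Sum>r<K * B. eta ((1 / B) * d (r div B)))"
    using entropy_eq_sum_eta[OF kron_one_unitary[OF P(1)]] by simp
  also have "\<dots> = (\<Sum>p<K. \<Sum>q<B. eta (d p / B))"
    unfolding sum_lessThan_mult using B by (intro sum.cong) auto
  also have "\<dots> = (\<Sum>p<K. eta (d p) + d p * log 2 B)"
    using B P(3) by (intro sum.cong) (auto simp: eta_divide field_simps)
  also have "\<dots> = entropy (ptrace_B K B Y) + log 2 B"
    unfolding P(2) entropy_eq_sum_eta[OF P(1)] by (simp add: sum.distrib s flip: sum_distrib_right)
  finally show ?thesis .
qed

lemma mtrace_ptrace_B: "Y \<in> carrier_mat (K * B) (K * B) \<Longrightarrow> mtrace (ptrace_B K B Y) = mtrace Y"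
  by (auto simp: mtrace_def ptrace_B_def sum_lessThan_mult)

text \<open>The quadratic form of the partial trace at \<open>v\<close> is the sum over q of the
  forms of \<open>Y\<close> at v tensor |q>.\<close>

lemma psd_ptrace_B:
  assumes Y: "psd (K * B) Y"
  shows "psd K (ptrace_B K B Y)"
  unfolding psd_def
proof (intro conjI ballI)
  note y = psdD[OF Y]
  have "cnj (Y $$ (j, i)) = Y $$ (i, j)" if "i < K * B" "j < K * B" for i j
    using arg_cong[OF y(2), of "\<lambda>X. X $$ (i, j)"] y(1) that by auto
  then show "mat_adjoint (ptrace_B K B Y) = ptrace_B K B Y"
    by (intro eq_matI) (auto simp: ptrace_B_def pair_index_less)
  fix v :: "complex vec" assume v: "v \<in> carrier_vec K"
  \<comment> \<open>\<open>w q\<close> is the product vector v tensor |q>.\<close>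
  define w where "w q = vec (K * B) (\<lambda>r. if r mod B = q then v $ (r div B) else 0)" for q
  have w: "w q \<in> carrier_vec (K * B)" for q by (simp add: w_def)
  have w_ind: "w q $ (p * B + q') = (if q' = q then v $ p else 0)" if "p < K" "q' < B" for p q q'
    using that by (auto simp: w_def pair_index_less)
  have "conjugate (w q) \<bullet> (Y *\<^sub>v w q) = (\<Sum>p<K. \<Sum>p'<K. cnj (v $ p) * Y $$ (p * B + q, p' * B + q) * v $ p')"
    if q: "q < B" for q
  proof -
    have "conjugate (w q) \<bullet> (Y *\<^sub>v w q)
      = (\<Sum>p<K. \<Sum>q1<B. \<Sum>p'<K. \<Sum>q2<B. cnj (w q $ (p * B + q1)) * Y $$ (p * B + q1, p' * B + q2) * w q $ (p' * B + q2))"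
      unfolding quadratic_form_sum[OF y(1) w] sum_lessThan_mult ..
    also have "\<dots> = (\<Sum>p<K. \<Sum>q1<B. if q1 = q then (\<Sum>p'<K. \<Sum>q2<B. if q2 = q then
        cnj (v $ p) * Y $$ (p * B + q1, p' * B + q2) * v $ p' else 0) else 0)"
      by (intro sum.cong) (auto simp: w_ind if_distrib cong: if_cong intro!: sum.cong)
    also have "\<dots> = (\<Sum>p<K. \<Sum>p'<K. cnj (v $ p) * Y $$ (p * B + q, p' * B + q) * v $ p')"
      using q by simp
    finally show ?thesis .
  qed
  then have "(\<Sum>q<B. conjugate (w q) \<bullet> (Y *\<^sub>v w q))
    = (\<Sum>q<B. \<Sum>p<K. \<Sum>p'<K. cnj (v $ p) * Y $$ (p * B + q, p' * B + q) * v $ p')" by simp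
  also have "\<dots> = (\<Sum>p<K. \<Sum>q<B. \<Sum>p'<K. cnj (v $ p) * Y $$ (p * B + q, p' * B + q) * v $ p')"
    by (rule sum.swap)
  also have "\<dots> = (\<Sum>p<K. \<Sum>p'<K. \<Sum>q<B. cnj (v $ p) * Y $$ (p * B + q, p' * B + q) * v $ p')"
    by (intro sum.cong refl sum.swap)
  also have "\<dots> = conjugate v \<bullet> (ptrace_B K B Y *\<^sub>v v)"
    unfolding quadratic_form_sum[OF ptrace_B_carrier v]
    by (intro sum.cong) (auto simp: ptrace_B_def sum_distrib_left sum_distrib_right)
  finally have "conjugate v \<bullet> (ptrace_B K B Y *\<^sub>v v) = (\<Sum>q<B. conjugate (w q) \<bullet> (Y *\<^sub>v w q))" by simp
  then show "0 \<le> Re (conjugate v \<bullet> (ptrace_B K B Y *\<^sub>v v))"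
    using y(3)[OF w] by (simp add: sum_nonneg)
qed simp

lemma ptrace_B_add:
  assumes "X \<in> carrier_mat (K * B) (K * B)" "Y \<in> carrier_mat (K * B) (K * B)"
  shows "ptrace_B K B (X + Y) = ptrace_B K B X + ptrace_B K B Y"
  using assms by (intro eq_matI) (auto simp: ptrace_B_def pair_index_less sum.distrib)

lemma ptrace_B_smult:
  assumes "X \<in> carrier_mat (K * B) (K * B)"
  shows "ptrace_B K B (c \<cdot>\<^sub>m X) = c \<cdot>\<^sub>m ptrace_B K B X"
  using assms by (intro eq_matI) (auto simp: ptrace_B_def pair_index_less sum_distrib_left)

lemma ptrace_B_one: "ptrace_B K B (1\<^sub>m (K * B)) = of_nat B \<cdot>\<^sub>m 1\<^sub>m K"
  by (intro eq_matI) (auto simp: ptrace_B_def pair_index_less)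

section \<open>Embedding H as S_0 and compressing back to it\<close>

lemma sum_if_lessThan:
  fixes f :: "nat \<Rightarrow> 'a::comm_monoid_add"
  assumes "h \<le> n"
  shows "(\<Sum>i<n. if i < h then f i else 0) = (\<Sum>i<h. f i)"
proof -
  have "(\<Sum>i<n. if i < h then f i else 0) = (\<Sum>i\<in>{..<n} \<inter> {..<h}. f i)"
    by (subst sum.inter_restrict) (auto intro!: sum.cong)
  also have "{..<n} \<inter> {..<h} = {..<h}" using assms by auto
  finally show ?thesis .
qed

lemma embed0_carrier [simp]: "embed0 dA dH X \<in> carrier_mat (dA * dH) (dA * dH)"
  by (simp add: embed0_def)

lemma mtrace_embed0:
  assumes "0 < dA" "X \<in> carrier_mat dH dH"
  shows "mtrace (embed0 dA dH X) = mtrace X"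
proof -
  have "mtrace (embed0 dA dH X) = (\<Sum>i<dA * dH. if i < dH then X $$ (i, i) else 0)"
    unfolding mtrace_def embed0_def by (auto intro!: sum.cong)
  also have "\<dots> = (\<Sum>i<dH. X $$ (i, i))" using assms by (intro sum_if_lessThan) auto
  finally show ?thesis using assms by (simp add: mtrace_def)
qed

lemma psd_embed0:
  assumes dA: "0 < dA" and X: "psd dH X"
  shows "psd (dA * dH) (embed0 dA dH X)"
  unfolding psd_def
proof (intro conjI ballI)
  note x = psdD[OF X]
  have h: "dH \<le> dA * dH" using dA by simp
  have "cnj (X $$ (j, i)) = X $$ (i, j)" if "i < dH" "j < dH" for i j
    using arg_cong[OF x(2), of "\<lambda>X. X $$ (i, j)"] x(1) that by auto
  then show "mat_adjoint (embed0 dA dH X) = embed0 dA dH X"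
    by (intro eq_matI) (auto simp: embed0_def)
  fix v :: "complex vec" assume v: "v \<in> carrier_vec (dA * dH)"
  define u where "u = vec dH (\<lambda>i. v $ i)"
  have u: "u \<in> carrier_vec dH" by (simp add: u_def)
  have "conjugate v \<bullet> (embed0 dA dH X *\<^sub>v v) = (\<Sum>i<dA * dH. if i < dH then
      (\<Sum>j<dA * dH. if j < dH then cnj (v $ i) * X $$ (i, j) * v $ j else 0) else 0)"
    unfolding quadratic_form_sum[OF embed0_carrier v]
    by (intro sum.cong) (auto simp: embed0_def intro!: sum.cong)
  also have "\<dots> = conjugate u \<bullet> (X *\<^sub>v u)"
    unfolding sum_if_lessThan[OF h] quadratic_form_sum[OF x(1) u] by (intro sum.cong) (auto simp: u_def)
  finally show "0 \<le> Re (conjugate v \<bullet> (embed0 dA dH X *\<^sub>v v))" using x(3)[OF u] by simp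
qed simp

text \<open>Compression to the span of the first \<open>h\<close> basis vectors, which for
  \<open>h = dH\<close> is S_0 identified with H.\<close>

definition corner :: "nat \<Rightarrow> complex mat \<Rightarrow> complex mat" where
  "corner h M = mat h h (\<lambda>(i, j). M $$ (i, j))"

lemma corner_carrier [simp]: "corner h M \<in> carrier_mat h h"
  by (simp add: corner_def)

lemma psd_corner:
  assumes h: "h \<le> n" and M: "psd n M"
  shows "psd h (corner h M)"
  unfolding psd_def
proof (intro conjI ballI)
  note m = psdD[OF M]
  have "cnj (M $$ (j, i)) = M $$ (i, j)" if "i < n" "j < n" for i j
    using arg_cong[OF m(2), of "\<lambda>X. X $$ (i, j)"] m(1) that by auto
  then show "mat_adjoint (corner h M) = corner h M"
    using h by (intro eq_matI) (auto simp: corner_def)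
  fix v :: "complex vec" assume v: "v \<in> carrier_vec h"
  define u where "u = vec n (\<lambda>i. if i < h then v $ i else 0)"
  have u: "u \<in> carrier_vec n" by (simp add: u_def)
  have "conjugate u \<bullet> (M *\<^sub>v u) = (\<Sum>i<n. if i < h then
      (\<Sum>j<n. if j < h then cnj (v $ i) * M $$ (i, j) * v $ j else 0) else 0)"
    unfolding quadratic_form_sum[OF m(1) u]
    by (intro sum.cong) (auto simp: u_def intro!: sum.cong)
  also have "\<dots> = conjugate v \<bullet> (corner h M *\<^sub>v v)"
    unfolding sum_if_lessThan[OF h] quadratic_form_sum[OF corner_carrier v]
    by (intro sum.cong) (auto simp: corner_def)
  finally show "0 \<le> Re (conjugate v \<bullet> (corner h M *\<^sub>v v))" using m(3)[OF u] by simp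
qed simp

section \<open>The Weyl twirl\<close>

lemma shiftX_pow:
  "shiftX e ^\<^sub>m a \<in> carrier_mat e e \<and>
   (\<forall>j<e. \<forall>k<e. (shiftX e ^\<^sub>m a) $$ (j, k) = (if j = (k + a) mod e then 1 else 0))"
proof (induction a)
  case 0
  show ?case by (auto simp: shiftX_def)
next
  case (Suc a)
  have X: "shiftX e \<in> carrier_mat e e" by (simp add: shiftX_def)
  have "(shiftX e ^\<^sub>m Suc a) $$ (j, k) = (if j = (k + Suc a) mod e then 1 else 0)" if jk: "j < e" "k < e" for j k
  proof -
    have "(shiftX e ^\<^sub>m Suc a) $$ (j, k) = (\<Sum>l<e. (shiftX e ^\<^sub>m a) $$ (j, l) * shiftX e $$ (l, k))"
      using index_mat_mult_sum[OF conjunct1[OF Suc.IH] X jk] by simp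
    also have "\<dots> = (\<Sum>l<e. if l = (k + 1) mod e then (if j = (l + a) mod e then 1 else 0) else 0)"
      using Suc.IH jk by (intro sum.cong) (auto simp: shiftX_def)
    also have "\<dots> = (if j = ((k + 1) mod e + a) mod e then 1 else 0)" using jk by simp
    also have "((k + 1) mod e + a) mod e = (k + Suc a) mod e" by (simp add: mod_add_left_eq)
    finally show ?thesis .
  qed
  moreover have "shiftX e ^\<^sub>m Suc a \<in> carrier_mat e e" using Suc.IH X by auto
  ultimately show ?case by blast
qed

lemma clockZ_pow:
  "clockZ e ^\<^sub>m b \<in> carrier_mat e e \<and>
   (\<forall>j<e. \<forall>k<e. (clockZ e ^\<^sub>m b) $$ (j, k) = (if j = k then cis (2 * pi * real k / real e) ^ b else 0))"
proof (induction b)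
  case 0
  show ?case by (auto simp: clockZ_def)
next
  case (Suc b)
  have Z: "clockZ e \<in> carrier_mat e e" by (simp add: clockZ_def)
  have "(clockZ e ^\<^sub>m Suc b) $$ (j, k) = (if j = k then cis (2 * pi * real k / real e) ^ Suc b else 0)"
    if jk: "j < e" "k < e" for j k
  proof -
    have "(clockZ e ^\<^sub>m Suc b) $$ (j, k) = (\<Sum>l<e. (clockZ e ^\<^sub>m b) $$ (j, l) * clockZ e $$ (l, k))"
      using index_mat_mult_sum[OF conjunct1[OF Suc.IH] Z jk] by simp
    also have "\<dots> = (\<Sum>l<e. if l = k then (if j = k then cis (2 * pi * real k / real e) ^ Suc b else 0) else 0)"
      using Suc.IH jk by (intro sum.cong) (auto simp: clockZ_def)
    also have "\<dots> = (if j = k then cis (2 * pi * real k / real e) ^ Suc b else 0)" using jk by simp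
    finally show ?thesis .
  qed
  moreover have "clockZ e ^\<^sub>m Suc b \<in> carrier_mat e e" using Suc.IH Z by auto
  ultimately show ?case by blast
qed

lemma weyl_carrier [simp]: "weyl e a b \<in> carrier_mat e e"
  unfolding weyl_def using shiftX_pow[of e a] clockZ_pow[of e b] by auto

lemma dim_weyl [simp]: "dim_row (weyl e a b) = e" "dim_col (weyl e a b) = e"
  using carrier_matD[OF weyl_carrier] by auto

lemma weyl_index:
  assumes jk: "j < e" "k < e"
  shows "weyl e a b $$ (j, k) = (if j = (k + a) mod e then cis (2 * pi * real k / real e) ^ b else 0)"
proof -
  have "weyl e a b $$ (j, k) = (\<Sum>l<e. (shiftX e ^\<^sub>m a) $$ (j, l) * (clockZ e ^\<^sub>m b) $$ (l, k))"
    unfolding weyl_def using index_mat_mult_sum[OF conjunct1[OF shiftX_pow] conjunct1[OF clockZ_pow] jk] .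
  also have "\<dots> = (\<Sum>l<e. if l = k then (if j = (l + a) mod e then cis (2 * pi * real k / real e) ^ b else 0) else 0)"
    using jk by (intro sum.cong) (auto simp: shiftX_pow clockZ_pow)
  finally show ?thesis using jk by simp
qed

text \<open>For k and l distinct the ratio of the two roots of unity is a root of unity other than
  1, so its geometric sum over a full period vanishes.\<close>

lemma sum_cis_orthogonal:
  assumes "k < e" "l < e"
  shows "(\<Sum>b<e. cis (2 * pi * real k / real e) ^ b * cnj (cis (2 * pi * real l / real e) ^ b))
    = (if k = l then of_nat e else 0)"
proof -
  define z where "z k = cis (2 * pi * real k / real e)" for k
  have e: "e > 0" using assms by simp
  have bij: "bij_betw z {..<e} {z. z ^ e = 1}" unfolding z_def by (rule bij_betw_roots_unity[OF e])
  then have root: "z k ^ e = 1" "z l ^ e = 1" using assms by (auto simp: bij_betw_def)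
  have unit: "z i * cnj (z i) = 1" for i by (simp add: z_def cis_cnj cis_mult)
  have *: "(\<Sum>b<e. z k ^ b * cnj (z l ^ b)) = (\<Sum>b<e. (z k * cnj (z l)) ^ b)"
    by (simp add: power_mult_distrib)
  show ?thesis
  proof (cases "k = l")
    case True
    then show ?thesis using * unit by (simp add: z_def)
  next
    case False
    then have "z k \<noteq> z l" using bij assms by (auto simp: bij_betw_def inj_on_def)
    then have "z k * cnj (z l) \<noteq> 1"
      using unit[of l] by (metis mult.assoc mult.commute mult.right_neutral)
    moreover have "(z k * cnj (z l)) ^ e = 1"
      using root by (simp add: power_mult_distrib flip: complex_cnj_power)
    ultimately have "(\<Sum>b<e. (z k * cnj (z l)) ^ b) = 0" by (simp add: geometric_sum)
    then show ?thesis using False * by (simp add: z_def)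
  qed
qed

lemma sum_shift_unique:
  fixes j k e :: nat
  assumes "j < e" "k < e"
  shows "(\<Sum>a<e. if j = (k + a) mod e then (1::complex) else 0) = 1"
proof -
  have "j = (k + a) mod e \<longleftrightarrow> a = (if k \<le> j then j - k else j + e - k)" if "a < e" for a
    using assms that by (cases "k + a < e") (auto simp: le_mod_geq)
  then have "(\<Sum>a<e. if j = (k + a) mod e then (1::complex) else 0)
    = (\<Sum>a<e. if a = (if k \<le> j then j - k else j + e - k) then 1 else 0)"
    by (intro sum.cong) auto
  moreover have "(if k \<le> j then j - k else j + e - k) < e" using assms by auto
  ultimately show ?thesis by (simp only: sum.delta finite_lessThan lessThan_iff if_True)
qed

text \<open>Summing over the phases \<open>b\<close> removes the off-diagonal entries of
  \<open>C\<close>, and summing over the shifts \<open>a\<close> carries each diagonal entry once to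
  every position. Division by \<open>e^2\<close> then leaves the identity times the trace over
  \<open>e\<close>.\<close>

lemma weyl_twirl:
  assumes C: "C \<in> carrier_mat e e" and j: "j < e" "j' < e"
  shows "(\<Sum>a<e. \<Sum>b<e. (weyl e a b * C * mat_adjoint (weyl e a b)) $$ (j, j'))
    = (if j = j' then of_nat e * mtrace C else 0)"
proof -
  define z where "z k = cis (2 * pi * real k / real e)" for k
  define s where "s j k a = (if j = (k + a) mod e then (1::complex) else 0)" for j k a
  have W: "weyl e a b $$ (j, k) = s j k a * z k ^ b" if "j < e" "k < e" for a b j k
    using weyl_index[OF that] by (simp add: s_def z_def)
  have orth: "(\<Sum>b<e. z k ^ b * cnj (z l ^ b)) = (if k = l then of_nat e else 0)" if "k < e" "l < e" for k l
    unfolding z_def by (rule sum_cis_orthogonal[OF that])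
  have ent: "(weyl e a b * C * mat_adjoint (weyl e a b)) $$ (j, j')
    = (\<Sum>l<e. \<Sum>k<e. (s j k a * C $$ (k, l) * s j' l a) * (z k ^ b * cnj (z l ^ b)))" for a b
  proof -
    have "(weyl e a b * C * mat_adjoint (weyl e a b)) $$ (j, j')
      = (\<Sum>l<e. (weyl e a b * C) $$ (j, l) * cnj (weyl e a b $$ (j', l)))"
      using j by (subst index_mat_mult_sum[OF mult_carrier_mat[OF weyl_carrier C], of _ e])
        (auto simp del: index_mult_mat(1))
    also have "\<dots> = (\<Sum>l<e. (\<Sum>k<e. weyl e a b $$ (j, k) * C $$ (k, l)) * cnj (weyl e a b $$ (j', l)))"
      using j by (intro sum.cong refl) (simp only: lessThan_iff index_mat_mult_sum[OF weyl_carrier C])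
    also have "\<dots> = (\<Sum>l<e. \<Sum>k<e. (s j k a * C $$ (k, l) * s j' l a) * (z k ^ b * cnj (z l ^ b)))"
      unfolding sum_distrib_right using j by (intro sum.cong refl) (auto simp: W s_def)
    finally show ?thesis .
  qed
  \<comment> \<open>Orthogonality leaves k = l, and a single shift \<open>a\<close> sends k to only
    one position, which forces j = j'.\<close>
  have "(\<Sum>b<e. (weyl e a b * C * mat_adjoint (weyl e a b)) $$ (j, j'))
    = (\<Sum>k<e. of_nat e * C $$ (k, k) * (if j = j' then s j k a else 0))" for a
  proof -
    have "(\<Sum>b<e. (weyl e a b * C * mat_adjoint (weyl e a b)) $$ (j, j'))
      = (\<Sum>l<e. \<Sum>b<e. \<Sum>k<e. (s j k a * C $$ (k, l) * s j' l a) * (z k ^ b * cnj (z l ^ b)))"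
      unfolding ent by (rule sum.swap)
    also have "\<dots> = (\<Sum>l<e. \<Sum>k<e. \<Sum>b<e. (s j k a * C $$ (k, l) * s j' l a) * (z k ^ b * cnj (z l ^ b)))"
      by (intro sum.cong refl sum.swap)
    also have "\<dots> = (\<Sum>l<e. \<Sum>k<e. if k = l then s j k a * C $$ (k, l) * s j' l a * of_nat e else 0)"
      unfolding sum_distrib_left[symmetric] by (intro sum.cong refl) (simp add: orth del: complex_cnj_power)
    also have "\<dots> = (\<Sum>l<e. s j l a * C $$ (l, l) * s j' l a * of_nat e)"
      by (intro sum.cong refl) (auto simp: sum.delta)
    also have "\<dots> = (\<Sum>k<e. of_nat e * C $$ (k, k) * (if j = j' then s j k a else 0))"
      using j by (intro sum.cong refl) (auto simp: s_def)
    finally show ?thesis .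
  qed
  then have "(\<Sum>a<e. \<Sum>b<e. (weyl e a b * C * mat_adjoint (weyl e a b)) $$ (j, j'))
    = (\<Sum>k<e. \<Sum>a<e. of_nat e * C $$ (k, k) * (if j = j' then s j k a else 0))"
    by (simp only:) (rule sum.swap)
  also have "\<dots> = (\<Sum>k<e. of_nat e * C $$ (k, k) * (if j = j' then 1 else 0))"
    unfolding sum_distrib_left[symmetric]
    using sum_shift_unique[OF j(1)] by (intro sum.cong refl arg_cong2[where f = "(*)"]) (auto simp: s_def)
  also have "\<dots> = (if j = j' then of_nat e * mtrace C else 0)"
    using C by (auto simp: mtrace_def sum_distrib_left)
  finally show ?thesis .
qed

section \<open>Dephasing followed by the twirl\<close>

lemma D_S0_index:
  assumes R: "R \<in> carrier_mat (dA * dH) (dA * dH)" and ij: "i < dA * dH" "j < dA * dH"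
  shows "D_S0 dA dH R $$ (i, j) = (if (i < dH) = (j < dH) then R $$ (i, j) else 0)"
proof -
  define n where "n = dA * dH"
  define s where "s i = (if i < dH then 1 else - 1 :: complex)" for i
  have V: "Vmat dA dH \<in> carrier_mat n n" by (simp add: Vmat_def n_def)
  have VR: "(Vmat dA dH * R) $$ (i, l) = s i * R $$ (i, l)" if "l < n" for l
  proof -
    have "(Vmat dA dH * R) $$ (i, l) = (\<Sum>k<n. if k = i then s i * R $$ (k, l) else 0)"
      unfolding index_mat_mult_sum[OF V R[folded n_def] ij(1)[folded n_def] that]
      using ij that by (intro sum.cong) (auto simp: Vmat_def s_def n_def)
    then show ?thesis using ij by (simp add: n_def)
  qed
  have "(Vmat dA dH * R * mat_adjoint (Vmat dA dH)) $$ (i, j)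
    = (\<Sum>l<n. (Vmat dA dH * R) $$ (i, l) * mat_adjoint (Vmat dA dH) $$ (l, j))"
    using V R ij by (intro index_mat_mult_sum[of _ n n _ n]) (auto simp: n_def)
  also have "\<dots> = (\<Sum>l<n. if l = j then s i * R $$ (i, j) * s j else 0)"
    using ij VR V by (intro sum.cong) (auto simp: Vmat_def s_def n_def)
  also have "\<dots> = s i * R $$ (i, j) * s j" using ij by (simp add: n_def)
  finally have "D_S0 dA dH R $$ (i, j) = 1/2 * (s i * R $$ (i, j) * s j + R $$ (i, j))"
    unfolding D_S0_def using V R ij by (simp add: n_def del: index_mult_mat(1))
  \<comment> \<open>Equal signs double the entry before it is halved; opposite signs cancel
    it.\<close>
  then show ?thesis by (cases "i < dH"; cases "j < dH") (simp_all add: s_def)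
qed

lemma sum_lessThan_add:
  fixes f :: "nat \<Rightarrow> 'a::comm_monoid_add"
  shows "(\<Sum>i<m + n. f i) = (\<Sum>i<m. f i) + (\<Sum>i<n. f (m + i))"
  by (induction n) (auto simp: add.assoc)

text \<open>Dephasing makes the input block diagonal. The Weyl operators fix the block on S_0 and
  replace the other block by its average, whose trace is what the S_0 block leaves of the trace of
  \<open>R\<close>.\<close>

lemma Mtwirl_D_S0:
  assumes dA: "2 \<le> dA" and dH: "0 < dH" and R: "R \<in> carrier_mat (dA * dH) (dA * dH)"
  shows "Mtwirl dA dH (D_S0 dA dH R) = embed0 dA dH (corner dH R)
    + ((mtrace R - mtrace (corner dH R)) / of_nat ((dA - 1) * dH))
      \<cdot>\<^sub>m real_diag (dA * dH) (\<lambda>i. if i < dH then 0 else 1)"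
    (is "_ = ?rhs")
proof -
  define e where "e = (dA - 1) * dH"
  have e0: "e > 0" using dA dH by (simp add: e_def)
  have n: "dA * dH = dH + e" using dA by (cases dA) (auto simp: e_def)
  note R = R[unfolded n]
  define A where "A = corner dH R"
  define C where "C = mat e e (\<lambda>(i, j). R $$ (dH + i, dH + j))"
  have A: "A \<in> carrier_mat dH dH" and C: "C \<in> carrier_mat e e" by (simp_all add: A_def C_def)
  have D: "D_S0 dA dH R = four_block_mat A (0\<^sub>m dH e) (0\<^sub>m e dH) C"
  proof (rule eq_matI)
    fix i j assume "i < dim_row (four_block_mat A (0\<^sub>m dH e) (0\<^sub>m e dH) C)"
      "j < dim_col (four_block_mat A (0\<^sub>m dH e) (0\<^sub>m e dH) C)"
    then have ij: "i < dH + e" "j < dH + e" using A C by auto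
    show "D_S0 dA dH R $$ (i, j) = four_block_mat A (0\<^sub>m dH e) (0\<^sub>m e dH) C $$ (i, j)"
      using ij A C D_S0_index[of R dA dH i j, unfolded n, OF R ij] by (auto simp: A_def C_def corner_def)
  qed (use A C R n in \<open>auto simp: D_S0_def Vmat_def\<close>)
  have W: "weyl_ext dA dH a b * D_S0 dA dH R * mat_adjoint (weyl_ext dA dH a b)
    = four_block_mat A (0\<^sub>m dH e) (0\<^sub>m e dH) (weyl e a b * C * mat_adjoint (weyl e a b))" for a b
  proof -
    have w: "weyl e a b \<in> carrier_mat e e" "mat_adjoint (weyl e a b) \<in> carrier_mat e e"
      by simp_all
    have ext: "weyl_ext dA dH a b = four_block_mat (1\<^sub>m dH) (0\<^sub>m dH e) (0\<^sub>m e dH) (weyl e a b)"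
      by (simp add: weyl_ext_def e_def Let_def)
    have adj: "mat_adjoint (weyl_ext dA dH a b)
      = four_block_mat (1\<^sub>m dH) (0\<^sub>m dH e) (0\<^sub>m e dH) (mat_adjoint (weyl e a b))"
      unfolding ext by (rule eq_matI) auto
    have wC: "weyl e a b * C \<in> carrier_mat e e" using w C by auto
    then have wCw: "weyl e a b * C * mat_adjoint (weyl e a b) \<in> carrier_mat e e" using w by auto
    have "weyl_ext dA dH a b * D_S0 dA dH R = four_block_mat A (0\<^sub>m dH e) (0\<^sub>m e dH) (weyl e a b * C)"
      unfolding D ext
      by (subst mult_four_block_mat[OF one_carrier_mat zero_carrier_mat zero_carrier_mat w(1) A zero_carrier_mat zero_carrier_mat C])
        (use A C w wC in simp)
    then show ?thesis
      unfolding adj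
      by (simp only:, subst mult_four_block_mat[OF A zero_carrier_mat zero_carrier_mat wC one_carrier_mat zero_carrier_mat zero_carrier_mat w(2)])
        (use A C w wC wCw in simp)
  qed
  have tr: "mtrace R - mtrace A = mtrace C"
    using R by (simp add: mtrace_def A_def C_def corner_def sum_lessThan_add)
  show ?thesis
  proof (rule eq_matI)
    fix i j assume "i < dim_row ?rhs" "j < dim_col ?rhs"
    then have ij: "i < dH + e" "j < dH + e" using n by (auto simp: embed0_def)
    have "Mtwirl dA dH (D_S0 dA dH R) $$ (i, j) = (1 / (of_nat e)\<^sup>2) * (\<Sum>a<e. \<Sum>b<e.
        four_block_mat A (0\<^sub>m dH e) (0\<^sub>m e dH) (weyl e a b * C * mat_adjoint (weyl e a b)) $$ (i, j))"
      unfolding Mtwirl_def Let_def e_def[symmetric] W n using e0 ij by simp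
    also have "\<dots> = ?rhs $$ (i, j)"
    proof (cases "i < dH \<or> j < dH")
      case True
      \<comment> \<open>Outside the complementary block the summand is independent of
        \<open>a\<close> and \<open>b\<close>, so the \<open>e^2\<close> equal terms cancel the
        prefactor.\<close>
      then have "four_block_mat A (0\<^sub>m dH e) (0\<^sub>m e dH) (weyl e a b * C * mat_adjoint (weyl e a b)) $$ (i, j)
        = (if i < dH \<and> j < dH then A $$ (i, j) else 0)" for a b
        using ij A by auto
      then show ?thesis
        using True ij e0 n by (auto simp: embed0_def real_diag_def A_def[symmetric] power2_eq_square)
    next
      case False
      then have "four_block_mat A (0\<^sub>m dH e) (0\<^sub>m e dH) (weyl e a b * C * mat_adjoint (weyl e a b)) $$ (i, j)
        = (weyl e a b * C * mat_adjoint (weyl e a b)) $$ (i - dH, j - dH)" for a b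
        using ij A by (auto simp del: index_mult_mat(1))
      moreover have "i - dH < e" "j - dH < e" "i - dH = j - dH \<longleftrightarrow> i = j" using False ij by auto
      ultimately show ?thesis
        using False ij e0 n weyl_twirl[OF C, of "i - dH" "j - dH"]
        by (simp add: embed0_def real_diag_def A_def[symmetric] power2_eq_square tr del: index_mult_mat(1))
          (simp add: e_def)
    qed
    finally show "Mtwirl dA dH (D_S0 dA dH R) $$ (i, j) = ?rhs $$ (i, j)" .
  qed (use dA dH in \<open>auto simp: Mtwirl_def Let_def embed0_def\<close>)
qed

text \<open>For dim A = 1 the complement of S_0 is zero, so \<open>V\<close> is the identity and the
  twirl takes its default branch.\<close>

lemma Mtwirl_D_S0_trivial_ancilla:
  assumes R: "R \<in> carrier_mat dH dH"
  shows "Mtwirl 1 dH (D_S0 1 dH R) = embed0 1 dH (corner dH R)"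
  unfolding Mtwirl_def using D_S0_index[of R 1 dH] R
  by (intro eq_matI) (auto simp: D_S0_def Vmat_def embed0_def corner_def)

lemma corner_embed0:
  "0 < dA \<Longrightarrow> X \<in> carrier_mat dH dH \<Longrightarrow> corner dH (embed0 dA dH X) = X"
proof (rule eq_matI)
  fix i j assume dA: "0 < dA" and X: "X \<in> carrier_mat dH dH" and "i < dim_row X" "j < dim_col X"
  then have ij: "i < dH" "j < dH" by auto
  have "dH \<le> dA * dH" using dA by simp
  then have "i < dA * dH" "j < dA * dH" using ij by (auto intro: less_le_trans)
  then show "corner dH (embed0 dA dH X) $$ (i, j) = X $$ (i, j)"
    using ij by (simp add: corner_def embed0_def)
qed (auto simp: corner_def)

lemma embed0_smult:
  "X \<in> carrier_mat dH dH \<Longrightarrow> embed0 dA dH (c \<cdot>\<^sub>m X) = c \<cdot>\<^sub>m embed0 dA dH X"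
  by (rule eq_matI) (auto simp: embed0_def)

lemma mtrace_smult: "mtrace (c \<cdot>\<^sub>m M) = c * mtrace M" if "M \<in> carrier_mat n n"
  using that by (auto simp: mtrace_def sum_distrib_left)

lemma mtrace_add: "mtrace (M + N) = mtrace M + mtrace N" if "M \<in> carrier_mat n n" "N \<in> carrier_mat n n"
  using that by (auto simp: mtrace_def sum.distrib)

lemma psd_mtrace_real:
  assumes "psd n M"
  obtains s where "0 \<le> s" "mtrace M = complex_of_real s"
proof -
  obtain P d where P: "unitary n P" "M = P * real_diag n d * mat_adjoint P" "\<And>i. i < n \<Longrightarrow> 0 \<le> d i"
    using psd_diagonalization[OF assms] by blast
  show ?thesis
    by (rule that[of "\<Sum>i<n. d i"]) (use P mtrace_diagonalized[OF P(1)] in \<open>auto intro: sum_nonneg\<close>)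
qed

lemma psd_smult: "psd n M \<Longrightarrow> 0 \<le> a \<Longrightarrow> psd n (complex_of_real a \<cdot>\<^sub>m M)"
proof -
  assume M: "psd n M" and a: "0 \<le> a"
  have "complex_of_real a \<cdot>\<^sub>m M + complex_of_real 0 \<cdot>\<^sub>m M = complex_of_real a \<cdot>\<^sub>m M"
    using psdD(1)[OF M] by (intro eq_matI) auto
  then show ?thesis using psd_add_smult[OF M M a order_refl] by simp
qed

lemma density_maximally_mixed:
  assumes "0 < n"
  shows "density n (real_diag n (\<lambda>_. 1 / n))"
  using assms by (simp add: density_iff_psd psd_real_diag_iff mtrace_real_diag)

section \<open>The two channels of a unitary dilation\<close>

locale dilation =
  fixes dA dH dK dB :: nat and U :: "complex mat"
  assumes pos: "0 < dA" "0 < dH" "0 < dK" "0 < dB"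
    and dims: "dA * dH = dK * dB"
    and U: "unitary (dA * dH) U"
begin

text \<open>Both channels pass through this map: the Stinespring channel after embedding in S_0, and
  \<open>Phi'\<close> after dephasing and twirling, up to the factor that \<open>N_B\<close>
  attaches.\<close>

definition reduce :: "complex mat \<Rightarrow> complex mat" where
  "reduce X = ptrace_B dK dB (U * X * mat_adjoint U)"

definition perp_proj :: "complex mat" where
  "perp_proj = real_diag (dA * dH) (\<lambda>i. if i < dH then 0 else 1)"

lemma reduce_carrier [simp]: "reduce X \<in> carrier_mat dK dK"
  by (simp add: reduce_def)

lemma perp_proj_carrier [simp]: "perp_proj \<in> carrier_mat (dA * dH) (dA * dH)"
  by (simp add: perp_proj_def)

lemma psd_perp_proj: "psd (dA * dH) perp_proj"
  unfolding perp_proj_def psd_real_diag_iff by simp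

lemma stinespring_eq_reduce: "stinespring dA dH dK dB U X = reduce (embed0 dA dH X)"
  by (simp add: stinespring_def reduce_def)

lemma reduce_add:
  assumes "X \<in> carrier_mat (dA * dH) (dA * dH)" "Y \<in> carrier_mat (dA * dH) (dA * dH)"
  shows "reduce (X + Y) = reduce X + reduce Y"
proof -
  note u = unitaryD[OF U]
  have "U * (X + Y) * mat_adjoint U = U * X * mat_adjoint U + U * Y * mat_adjoint U"
    using u(1,2) assms
    by (simp add: mult_add_distrib_mat[of _ "dA * dH" "dA * dH" _ "dA * dH"]
        add_mult_distrib_mat[of _ "dA * dH" "dA * dH" _ _ "dA * dH"])
  moreover have "U * X * mat_adjoint U \<in> carrier_mat (dK * dB) (dK * dB)"
    "U * Y * mat_adjoint U \<in> carrier_mat (dK * dB) (dK * dB)"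
    using u assms unfolding dims by auto
  ultimately show ?thesis by (simp add: reduce_def ptrace_B_add)
qed

lemma reduce_smult:
  assumes "X \<in> carrier_mat (dA * dH) (dA * dH)"
  shows "reduce (c \<cdot>\<^sub>m X) = c \<cdot>\<^sub>m reduce X"
proof -
  note u = unitaryD[OF U]
  have "U * (c \<cdot>\<^sub>m X) * mat_adjoint U = c \<cdot>\<^sub>m (U * X * mat_adjoint U)"
    using u(1,2) assms
    by (simp add: mult_smult_distrib[of _ "dA * dH" "dA * dH" _ "dA * dH"]
        mult_smult_assoc_mat[of _ "dA * dH" "dA * dH" _ "dA * dH"])
  moreover have "U * X * mat_adjoint U \<in> carrier_mat (dK * dB) (dK * dB)"
    using u assms unfolding dims by auto
  ultimately show ?thesis by (simp add: reduce_def ptrace_B_smult)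
qed

lemma psd_reduce:
  assumes "psd (dA * dH) X"
  shows "psd dK (reduce X)"
  unfolding reduce_def
  by (rule psd_ptrace_B) (use psd_conj[OF assms unitaryD(1)[OF U]] in \<open>simp add: dims\<close>)

lemma mtrace_reduce:
  assumes "X \<in> carrier_mat (dA * dH) (dA * dH)"
  shows "mtrace (reduce X) = mtrace X"
proof -
  have "U * X * mat_adjoint U \<in> carrier_mat (dK * dB) (dK * dB)"
    using unitaryD[OF U] assms unfolding dims by auto
  then show ?thesis by (simp add: reduce_def mtrace_ptrace_B mtrace_unitary_conj[OF U assms])
qed

lemma reduce_density: "density (dA * dH) X \<Longrightarrow> density dK (reduce X)"
  by (auto simp: density_iff_psd psd_reduce mtrace_reduce psdD(1))

lemma density_embed0: "density dH X \<Longrightarrow> density (dA * dH) (embed0 dA dH X)"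
  using pos(1) by (auto simp: density_iff_psd psd_embed0 mtrace_embed0 psdD(1))

lemma entropy_Phi':
  assumes "density (dA * dH) (Mtwirl dA dH (D_S0 dA dH R))"
  shows "entropy (Phi' dA dH dK dB U R) = entropy (reduce (Mtwirl dA dH (D_S0 dA dH R))) + log 2 dB"
  using reduce_density[OF assms] unfolding Phi'_def reduce_def by (rule entropy_N_B[OF pos(4)])

section \<open>The reduced state of the complement of S_0\<close>

lemma reduce_one: "reduce (1\<^sub>m (dA * dH)) = of_nat dB \<cdot>\<^sub>m 1\<^sub>m dK"
  using unitaryD[OF U] by (simp add: reduce_def dims ptrace_B_one)

lemma embed0_one_plus_perp_proj: "embed0 dA dH (1\<^sub>m dH) + perp_proj = 1\<^sub>m (dA * dH)"
  by (rule eq_matI) (auto simp: embed0_def perp_proj_def real_diag_def)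

definition perp_dim :: nat where "perp_dim = (dA - 1) * dH"

definition tau :: "complex mat" where "tau = complex_of_real (1 / perp_dim) \<cdot>\<^sub>m reduce perp_proj"

lemma mtrace_perp_proj: "mtrace perp_proj = of_nat perp_dim"
proof -
  have "mtrace (1\<^sub>m (dA * dH)) = mtrace (embed0 dA dH (1\<^sub>m dH)) + mtrace perp_proj"
    unfolding embed0_one_plus_perp_proj[symmetric] by (rule mtrace_add[of _ "dA * dH"]) auto
  then have "of_nat (dA * dH) = (of_nat dH :: complex) + mtrace perp_proj"
    using pos(1) by (simp add: mtrace_embed0) (simp add: mtrace_def)
  moreover have "dA * dH = dH + perp_dim" using pos(1) by (simp add: perp_dim_def diff_mult_distrib)
  ultimately show ?thesis by simp
qed

lemma density_tau:
  assumes "2 \<le> dA"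
  shows "density dK tau"
proof -
  have "perp_dim > 0" using assms pos by (simp add: perp_dim_def)
  then show ?thesis
    unfolding density_iff_psd tau_def
    using psd_smult[OF psd_reduce[OF psd_perp_proj], of "1 / perp_dim"] mtrace_smult[OF reduce_carrier, of "complex_of_real (1 / perp_dim)" perp_proj]
    by (simp add: mtrace_reduce mtrace_perp_proj)
qed

text \<open>The projections onto S_0 and its complement add up to the identity, which reduces to
  \<open>dB\<close> times the identity. So \<open>tau\<close> is an affine function of the output on
  the maximally mixed state and is diagonal in the same basis.\<close>

lemma entropy_tau:
  assumes dA: "2 \<le> dA"
  shows "entropy (stinespring dA dH dK dB U (real_diag dH (\<lambda>_. 1 / dH))) \<le> entropy tau + 1 / dA"
proof -
  define \<omega> where "\<omega> = stinespring dA dH dK dB U (real_diag dH (\<lambda>_. 1 / dH))"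
  have perp_dim: "perp_dim > 0" using dA pos by (simp add: perp_dim_def)
  have dens: "density dK \<omega>" unfolding \<omega>_def stinespring_eq_reduce
    by (intro reduce_density density_embed0 density_maximally_mixed pos)
  then obtain P w where P: "unitary dK P" "\<omega> = P * real_diag dK w * mat_adjoint P" "\<And>i. i < dK \<Longrightarrow> 0 \<le> w i"
    using psd_diagonalization density_iff_psd by metis
  note p = unitaryD[OF P(1)]
  have "complex_of_real (\<Sum>i<dK. w i) = 1"
    using dens mtrace_diagonalized[OF P(1)] P(2) by (simp add: density_iff_psd)
  then have s: "(\<Sum>i<dK. w i) = 1" using of_real_eq_1_iff by blast
  have "real_diag dH (\<lambda>_. 1 / dH) = (1 / of_nat dH) \<cdot>\<^sub>m 1\<^sub>m dH"
    by (rule eq_matI) (auto simp: real_diag_def)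
  then have \<omega>: "\<omega> = (1 / of_nat dH) \<cdot>\<^sub>m reduce (embed0 dA dH (1\<^sub>m dH))"
    by (simp add: \<omega>_def stinespring_eq_reduce embed0_smult reduce_smult)
  have TQ: "reduce (embed0 dA dH (1\<^sub>m dH)) + reduce perp_proj = of_nat dB \<cdot>\<^sub>m 1\<^sub>m dK"
    using reduce_add[OF embed0_carrier perp_proj_carrier, of "1\<^sub>m dH"] by (simp add: embed0_one_plus_perp_proj reduce_one)
  have one: "P * real_diag dK (\<lambda>_. 1) * mat_adjoint P = 1\<^sub>m dK"
  proof -
    have "real_diag dK (\<lambda>_. 1) = 1\<^sub>m dK" by (rule eq_matI) (auto simp: real_diag_def)
    then show ?thesis using p by simp
  qed
  have tau_eq: "tau = P * real_diag dK (\<lambda>i. (dB - dH * w i) / perp_dim) * mat_adjoint P"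
  proof -
    have split: "real_diag dK (\<lambda>i. (dB - dH * w i) / perp_dim)
      = complex_of_real (dB / perp_dim) \<cdot>\<^sub>m real_diag dK (\<lambda>_. 1) + complex_of_real (- dH / perp_dim) \<cdot>\<^sub>m real_diag dK w"
      by (rule eq_matI) (auto simp: real_diag_def diff_divide_distrib)
    have "P * real_diag dK (\<lambda>i. (dB - dH * w i) / perp_dim) * mat_adjoint P
      = complex_of_real (dB / perp_dim) \<cdot>\<^sub>m 1\<^sub>m dK + complex_of_real (- dH / perp_dim) \<cdot>\<^sub>m \<omega>"
      unfolding one[symmetric] P(2) split using p(1,2)
      by (simp add: mult_add_distrib_mat[of _ dK dK _ dK] add_mult_distrib_mat[of _ dK dK _ _ dK]
        mult_smult_distrib[of _ dK dK _ dK] mult_smult_assoc_mat[of _ dK dK _ dK])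
    also have "\<dots> = tau"
    proof (rule eq_matI)
      fix i j assume "i < dim_row tau" "j < dim_col tau"
      then have ij: "i < dK" "j < dK" by (auto simp: tau_def carrier_matD[OF reduce_carrier])
      have "reduce (embed0 dA dH (1\<^sub>m dH)) $$ (i, j) + reduce perp_proj $$ (i, j) = of_nat dB * 1\<^sub>m dK $$ (i, j)"
        using arg_cong[OF TQ, of "\<lambda>M. M $$ (i, j)"] ij by (simp add: carrier_matD[OF reduce_carrier])
      then show "(complex_of_real (dB / perp_dim) \<cdot>\<^sub>m 1\<^sub>m dK + complex_of_real (- dH / perp_dim) \<cdot>\<^sub>m \<omega>) $$ (i, j) = tau $$ (i, j)"
        using ij perp_dim pos unfolding \<omega> tau_def by (simp add: carrier_matD[OF reduce_carrier] field_simps)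
    qed (auto simp: tau_def \<omega> carrier_matD[OF reduce_carrier])
    finally show ?thesis by simp
  qed
  \<comment> \<open>The factor \<open>dH\<close> cancels by \<open>dA * dH = dK * dB\<close>, which
    gives the eigenvalues the form used in \<open>sum_eta_complement\<close>.\<close>
  have t: "(dB - dH * w i) / perp_dim = (dA / dK - w i) / (dA - 1)" for i
  proof -
    have "real dA * real dH = real dK * real dB" using dims by (metis of_nat_mult)
    then have "real dB = dH * (dA / dK)" using pos by (simp add: field_simps)
    then have "dB - dH * w i = dH * (dA / dK - w i)" by (simp add: algebra_simps)
    moreover have "real perp_dim = dH * (dA - 1)" using dA by (simp add: perp_dim_def of_nat_diff)
    ultimately show ?thesis using pos by simp
  qed
  have "0 \<le> (dB - dH * w i) / perp_dim" if "i < dK" for i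
    using density_tau[OF dA] psd_conj_real_diag_nonneg[OF P(1) _ that] unfolding tau_eq density_iff_psd by blast
  then have "(\<Sum>i<dK. eta (w i)) \<le> (\<Sum>i<dK. eta ((dA / dK - w i) / (dA - 1))) + 1 / dA"
    using sum_eta_complement[OF dA pos(3) P(3) s] t dA by (simp add: of_nat_diff)
  moreover have "entropy \<omega> = (\<Sum>i<dK. eta (w i))" unfolding P(2) by (rule entropy_eq_sum_eta[OF P(1)])
  moreover have "entropy tau = (\<Sum>i<dK. eta ((dB - dH * w i) / perp_dim))"
    unfolding tau_eq by (rule entropy_eq_sum_eta[OF P(1)])
  ultimately show ?thesis unfolding t \<omega>_def by simp
qed

section \<open>Entropy bounds for single inputs and for the minima\<close>

lemma entropy_stinespring_nonneg: "density dH X \<Longrightarrow> 0 \<le> entropy (stinespring dA dH dK dB U X)"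
  unfolding stinespring_eq_reduce by (rule entropy_nonneg[OF reduce_density[OF density_embed0]])

lemma Smin_stinespring_le: "density dH X \<Longrightarrow> Smin dH (stinespring dA dH dK dB U) \<le> entropy (stinespring dA dH dK dB U X)"
  unfolding Smin_def using entropy_stinespring_nonneg by (intro cINF_lower bdd_belowI2[of _ 0]) auto

text \<open>An input supported on S_0 has all its trace in the corner block, so nothing is spread
  over the complement.\<close>

lemma twirl_embed0:
  assumes X: "density dH X"
  shows "Mtwirl dA dH (D_S0 dA dH (embed0 dA dH X)) = embed0 dA dH X"
proof (cases "dA = 1")
  case True
  then show ?thesis
    using Mtwirl_D_S0_trivial_ancilla[of "embed0 1 dH X" dH] corner_embed0[of 1 X dH] psdD(1) X
    by (auto simp: density_iff_psd embed0_def)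
next
  case False
  then have "2 \<le> dA" using pos by simp
  then have "Mtwirl dA dH (D_S0 dA dH (embed0 dA dH X))
    = embed0 dA dH X + 0 \<cdot>\<^sub>m real_diag (dA * dH) (\<lambda>i. if i < dH then 0 else 1)"
    using Mtwirl_D_S0[of dA dH "embed0 dA dH X"] pos X psdD(1)[of dH X]
    by (simp add: density_iff_psd corner_embed0 mtrace_embed0)
  also have "\<dots> = embed0 dA dH X" by (intro eq_matI) (auto simp: embed0_def)
  finally show ?thesis .
qed

text \<open>The reduced output is a mixture of a Stinespring output and \<open>tau\<close>. Each has
  entropy at least the minimum minus \<open>1 / dA\<close>, and concavity passes this bound to the
  mixture.\<close>

lemma twirl_entropy:
  assumes R: "density (dA * dH) R"
  defines "Y \<equiv> Mtwirl dA dH (D_S0 dA dH R)"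
  shows "density (dA * dH) Y" "Smin dH (stinespring dA dH dK dB U) - 1 / dA \<le> entropy (reduce Y)"
proof -
  have h: "dH \<le> dA * dH" using pos by simp
  define A where "A = corner dH R"
  have Rp: "psd (dA * dH) R" and Rt: "mtrace R = 1" using R by (auto simp: density_iff_psd)
  have A: "psd dH A" unfolding A_def by (rule psd_corner[OF h Rp])
  obtain s where s: "0 \<le> s" "mtrace A = complex_of_real s" using psd_mtrace_real[OF A] .
  have "density (dA * dH) Y \<and> Smin dH (stinespring dA dH dK dB U) - 1 / dA \<le> entropy (reduce Y)"
  proof (cases "dA = 1")
    case True
    have Rc: "R \<in> carrier_mat dH dH" using psdD(1)[OF Rp] True by simp
    have "A = R" unfolding A_def using Rc by (intro eq_matI) (auto simp: corner_def)
    then have Y: "Y = embed0 dA dH R" and dR: "density dH R"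
      using Mtwirl_D_S0_trivial_ancilla[OF Rc] R True unfolding Y_def A_def by auto
    have "Smin dH (stinespring dA dH dK dB U) - 1 / dA \<le> Smin dH (stinespring dA dH dK dB U)" by simp
    also have "\<dots> \<le> entropy (reduce Y)" using Smin_stinespring_le[OF dR] by (simp add: Y stinespring_eq_reduce)
    finally show ?thesis using density_embed0[OF dR] Y by simp
  next
    case False
    then have dA: "2 \<le> dA" using pos by simp
    have perp_dim: "perp_dim > 0" using dA pos by (simp add: perp_dim_def)
    \<comment> \<open>Here \<open>s\<close> is the weight of the input on S_0 and 1 - s is spread
      evenly over the complement. The coefficient 1 is written out to fit
      \<open>psd_add_smult\<close>.\<close>
    have Y: "Y = complex_of_real 1 \<cdot>\<^sub>m embed0 dA dH A + complex_of_real ((1 - s) / perp_dim) \<cdot>\<^sub>m perp_proj"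
      unfolding Y_def Mtwirl_D_S0[OF dA pos(2) psdD(1)[OF Rp]] Rt A_def[symmetric] s(2) perp_proj_def perp_dim_def
      by (intro eq_matI) (auto simp: embed0_def)
    have s1: "s \<le> 1"
    proof -
      \<comment> \<open>The diagonal entries of \<open>R\<close> outside S_0 are nonnegative, so
        dropping them cannot increase the trace.\<close>
      have "Re (mtrace A) = (\<Sum>i<dH. Re (R $$ (i, i)))" by (simp add: mtrace_def A_def corner_def)
      also have "\<dots> \<le> (\<Sum>i<dA * dH. Re (R $$ (i, i)))"
        using h psd_diag_nonneg[OF Rp] by (intro sum_mono2) auto
      also have "\<dots> = Re (mtrace R)" using psdD(1)[OF Rp] by (simp add: mtrace_def)
      finally show ?thesis using s Rt by simp
    qed
    have "psd (dA * dH) Y"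
      unfolding Y using s1 by (intro psd_add_smult psd_embed0 pos A psd_perp_proj) auto
    moreover have "mtrace Y = 1"
    proof -
      have "mtrace Y = mtrace (embed0 dA dH A) + complex_of_real ((1 - s) / perp_dim) * mtrace perp_proj"
        unfolding Y by (subst mtrace_add[of _ "dA * dH"])
          (simp_all add: mtrace_smult[OF embed0_carrier] mtrace_smult[OF perp_proj_carrier])
      then show ?thesis using perp_dim s pos by (simp add: mtrace_embed0[OF _ psdD(1)[OF A]] mtrace_perp_proj)
    qed
    ultimately have Yd: "density (dA * dH) Y" by (simp add: density_iff_psd)
    have "reduce Y = reduce (complex_of_real 1 \<cdot>\<^sub>m embed0 dA dH A) + reduce (complex_of_real ((1 - s) / perp_dim) \<cdot>\<^sub>m perp_proj)"
      unfolding Y by (rule reduce_add) auto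
    also have "\<dots> = reduce (embed0 dA dH A) + complex_of_real (1 - s) \<cdot>\<^sub>m tau"
      using reduce_smult[OF embed0_carrier, of 1 A] reduce_smult[OF perp_proj_carrier, of "complex_of_real ((1 - s) / perp_dim)"]
      by (intro eq_matI) (auto simp: tau_def carrier_matD[OF reduce_carrier])
    finally have TY: "reduce Y = reduce (embed0 dA dH A) + complex_of_real (1 - s) \<cdot>\<^sub>m tau" .
    have taup: "psd dK tau" using density_tau[OF dA] by (simp add: density_iff_psd)
    have min_tau: "Smin dH (stinespring dA dH dK dB U) - 1 / dA \<le> entropy tau"
      using Smin_stinespring_le[OF density_maximally_mixed[OF pos(2)]] entropy_tau[OF dA] by simp
    have "Smin dH (stinespring dA dH dK dB U) - 1 / dA \<le> entropy (reduce Y)"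
    proof (cases "s = 0")
      case True
      then have "A = 0\<^sub>m dH dH" using psd_mtrace_zero[OF A] s by simp
      \<comment> \<open>Writing the zero matrix as a multiple by 0 lets \<open>reduce_smult\<close>
        show that its reduction vanishes.\<close>
      then have "embed0 dA dH A = 0 \<cdot>\<^sub>m embed0 dA dH A" by (intro eq_matI) (auto simp: embed0_def)
      then have T0: "reduce (embed0 dA dH A) = 0 \<cdot>\<^sub>m reduce (embed0 dA dH A)" using reduce_smult[OF embed0_carrier] by metis
      have "reduce (embed0 dA dH A) $$ (i, j) = 0" if "i < dK" "j < dK" for i j
        by (subst T0) (use that in \<open>simp add: carrier_matD[OF reduce_carrier]\<close>)
      then have "reduce Y = tau" unfolding TY using True psdD(1)[OF taup] by (intro eq_matI) auto
      then show ?thesis using min_tau by simp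
    next
      case False
      then have s0: "s > 0" using s by simp
      \<comment> \<open>The normalized corner block is the state on H whose Stinespring output
        enters the mixture with weight \<open>s\<close>.\<close>
      define \<sigma> where "\<sigma> = complex_of_real (1 / s) \<cdot>\<^sub>m A"
      have "density dH \<sigma>"
        unfolding density_iff_psd \<sigma>_def using psd_smult[OF A, of "1 / s"] s s0
        by (simp add: mtrace_smult[OF psdD(1)[OF A]])
      note \<sigma> = this
      have "reduce (embed0 dA dH \<sigma>) = complex_of_real (1 / s) \<cdot>\<^sub>m reduce (embed0 dA dH A)"
        unfolding \<sigma>_def embed0_smult[OF psdD(1)[OF A]] by (rule reduce_smult) simp
      then have "reduce (embed0 dA dH A) = complex_of_real s \<cdot>\<^sub>m stinespring dA dH dK dB U \<sigma>"
        unfolding stinespring_eq_reduce using s0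
        by (intro eq_matI) (auto simp: carrier_matD[OF reduce_carrier])
      then have "s * entropy (stinespring dA dH dK dB U \<sigma>) + (1 - s) * entropy tau \<le> entropy (reduce Y)"
        unfolding TY using entropy_concave[OF _ taup s(1) s1, of "stinespring dA dH dK dB U \<sigma>"]
          reduce_density[OF density_embed0[OF \<sigma>]]
        by (simp add: density_iff_psd stinespring_eq_reduce)
      moreover have "s * (Smin dH (stinespring dA dH dK dB U) - 1 / dA) \<le> s * entropy (stinespring dA dH dK dB U \<sigma>)"
        using Smin_stinespring_le[OF \<sigma>] s pos by (intro mult_left_mono) (auto intro: order_trans[OF _ Smin_stinespring_le[OF \<sigma>]])
      moreover have "(1 - s) * (Smin dH (stinespring dA dH dK dB U) - 1 / dA) \<le> (1 - s) * entropy tau"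
        using min_tau s1 by (intro mult_left_mono) auto
      ultimately have "s * (Smin dH (stinespring dA dH dK dB U) - 1 / dA)
        + (1 - s) * (Smin dH (stinespring dA dH dK dB U) - 1 / dA) \<le> entropy (reduce Y)" by linarith
      then show ?thesis by (simp flip: distrib_right)
    qed
    then show ?thesis using Yd by simp
  qed
  then show "density (dA * dH) Y" "Smin dH (stinespring dA dH dK dB U) - 1 / dA \<le> entropy (reduce Y)" by auto
qed

text \<open>The first bound restricts the infimum for \<open>Phi'\<close> to inputs embedded in S_0,
  on which the two entropies differ by exactly \<open>log 2 dB\<close>. The second takes the infimum
  of the bound in \<open>twirl_entropy\<close> over all inputs.\<close>

lemma Smin_bounds:
  "Smin (dA * dH) (Phi' dA dH dK dB U) - log 2 dB \<le> Smin dH (stinespring dA dH dK dB U)"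
  "Smin dH (stinespring dA dH dK dB U) - 1 / dA \<le> Smin (dA * dH) (Phi' dA dH dK dB U) - log 2 dB"
proof -
  have ent: "entropy (Phi' dA dH dK dB U R) = entropy (reduce (Mtwirl dA dH (D_S0 dA dH R))) + log 2 dB"
    if "density (dA * dH) R" for R
    by (rule entropy_Phi'[OF twirl_entropy(1)[OF that]])
  have nonempty: "{X. density n X} \<noteq> {}" if "0 < n" for n using density_maximally_mixed[OF that] by blast
  have "log 2 dB \<le> entropy (Phi' dA dH dK dB U R)" if "density (dA * dH) R" for R
    unfolding ent[OF that] using entropy_nonneg[OF reduce_density[OF twirl_entropy(1)[OF that]]] by simp
  then have bdd: "bdd_below ((\<lambda>R. entropy (Phi' dA dH dK dB U R)) ` {R. density (dA * dH) R})"
    by (intro bdd_belowI2) auto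
  have "Smin (dA * dH) (Phi' dA dH dK dB U) - log 2 dB \<le> entropy (stinespring dA dH dK dB U X)"
    if X: "density dH X" for X
  proof -
    have "Smin (dA * dH) (Phi' dA dH dK dB U) \<le> entropy (Phi' dA dH dK dB U (embed0 dA dH X))"
      unfolding Smin_def using bdd density_embed0[OF X] by (intro cINF_lower) auto
    then show ?thesis
      by (simp add: ent[OF density_embed0[OF X]] twirl_embed0[OF X] stinespring_eq_reduce)
  qed
  then show "Smin (dA * dH) (Phi' dA dH dK dB U) - log 2 dB \<le> Smin dH (stinespring dA dH dK dB U)"
    unfolding Smin_def[of dH] using nonempty[OF pos(2)] by (intro cINF_greatest) auto
  have "Smin dH (stinespring dA dH dK dB U) - 1 / dA + log 2 dB \<le> Smin (dA * dH) (Phi' dA dH dK dB U)"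
    unfolding Smin_def[of "dA * dH"] using nonempty[of "dA * dH"] pos twirl_entropy(2)
    by (intro cINF_greatest) (auto simp: ent)
  then show "Smin dH (stinespring dA dH dK dB U) - 1 / dA \<le> Smin (dA * dH) (Phi' dA dH dK dB U) - log 2 dB"
    by simp
qed

end

theorem theorem7p11:
  fixes dA dH dK dB :: nat and U :: "complex mat"
  assumes "0 < dA" "0 < dH" "0 < dK" "0 < dB"
    and "dA * dH = dK * dB"
    and "unitary (dA * dH) U"
  shows "Smin dH (stinespring dA dH dK dB U) \<ge> Smin (dA * dH) (Phi' dA dH dK dB U) - log 2 (real dB)
       \<and> Smin (dA * dH) (Phi' dA dH dK dB U) - log 2 (real dB) \<ge> Smin dH (stinespring dA dH dK dB U) - 1 / real dA"
proof -
  interpret dilation dA dH dK dB U by unfold_locales (use assms in auto)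
  show ?thesis using Smin_bounds by simp
qed

end
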